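(* Fix $d\in\mathbb{N}$ and $n\ge d$. Let $\xi_1,\dots,\xi_n$ be (possibly dependent) random vectors in $\mathbb{R}^d$, let $S_0=0$ and $S_i=\xi_1+\dots+\xi_i$ for $1\le i\le n$, and let $\mathcal{Q}_{n,d}=\mathrm{conv}(S_0,S_1,\dots,S_n)$. Assume: (Ex) for every permutation $\pi$ of $\{1,\dots,n\}$, $(\xi_{\pi(1)},\dots,\xi_{\pi(n)})$ has the same distribution as $(\xi_1,\dots,\xi_n)$; (GP) for all $1\le i_1<\dots<i_d\le n$, the probability that $S_{i_1},\dots,S_{i_d}$ are linearly dependent is $0$. Then for every $j\in\{0,\dots,d-1\}$, $$\mathbb{E}\sum_{F\in\mathcal{F}_j(\mathcal{Q}_{n,d})}\alpha\big(N_F(\mathcal{Q}_{n,d})\big)=\frac{j!}{n!}\genfrac{[}{]}{0pt}{}{n+1}{j+1}.$$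
   Context: $\mathbb{N}=\{1,2,\dots\}$. The solid angle of a polyhedral cone $C$ (the set of nonnegative linear combinations of finitely many vectors) is $\alpha(C)=\mathbb{P}[Z\in C]$ with $Z$ uniformly distributed on the unit sphere of the linear hull of $C$; $\alpha(C)=1$ if $C$ is a linear subspace (including $C=\{0\}$). For a polytope $P$, $\mathcal{F}_j(P)$ is the set of its $j$-dimensional faces ($P$ itself being a face). The tangent cone of $P\subset\mathbb{R}^d$ at a face $F$ is $T_F(P)=\{v\in\mathbb{R}^d: f_0+\varepsilon v\in P\text{ for some }\varepsilon>0\}$, where $f_0$ is any point of the relative interior of $F$. The normal cone is the polar cone $N_F(P)=\{w:\langle w,u\rangle\le 0\ \text{for all } u\in T_F(P)\}$. For a random polytope, angles are computed for each realization. $\genfrac{[}{]}{0pt}{}{n}{m}$ is the (signless) Stirling number of the first kind, i.e. the number of permutations of an $n$-element set with exactly $m$ cycles. *)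

theory Defs
  imports "HOL-Probability.Probability" "HOL-Combinatorics.Stirling"
begin

section \<open>Solid angles\<close>

text \<open>
  The uniform distribution on the unit sphere of a linear subspace \<open>L\<close> is the rotation invariant
  Borel probability measure on that sphere. It is realised as a measure on the ambient space
  that is concentrated on \<open>sphere 0 1 \<inter> L\<close>. Existence and uniqueness (for \<open>L \<noteq> {0}\<close>) are
  proved in \<open>uniform_on_sphere_exists\<close> and \<open>uniform_on_sphere_unique\<close> below, so that
  the definite description in \<open>uniform_sphere\<close> is meaningful.
\<close>

definition uniform_on_sphere :: "'a::euclidean_space set \<Rightarrow> 'a measure \<Rightarrow> bool" where
  "uniform_on_sphere L \<mu> \<longleftrightarrow>
     prob_space \<mu> \<and> sets \<mu> = sets borel \<and> measure \<mu> (sphere 0 1 \<inter> L) = 1 \<and>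
     (\<forall>f. orthogonal_transformation f \<and> f ` L = L \<longrightarrow> distr \<mu> borel f = \<mu>)"

definition uniform_sphere :: "'a::euclidean_space set \<Rightarrow> 'a measure" where
  "uniform_sphere L = (THE \<mu>. uniform_on_sphere L \<mu>)"

definition solid_angle :: "'a::euclidean_space set \<Rightarrow> real" where
  "solid_angle C = (if subspace C then 1 else measure (uniform_sphere (span C)) C)"

section \<open>Tangent and normal cones\<close>

text \<open>
  The choice of the point \<open>f0\<close> in the relative interior of \<open>F\<close> is irrelevant, see
  \<open>tangent_cone_eq\<close> below.
\<close>

definition tangent_cone :: "'a::euclidean_space set \<Rightarrow> 'a set \<Rightarrow> 'a set" where
  "tangent_cone P F = {v. \<exists>f0\<in>rel_interior F. \<exists>\<epsilon>>0. f0 + \<epsilon> *\<^sub>R v \<in> P}"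

definition polar_cone :: "'a::euclidean_space set \<Rightarrow> 'a set" where
  "polar_cone C = {w. \<forall>u\<in>C. w \<bullet> u \<le> 0}"

definition normal_cone :: "'a::euclidean_space set \<Rightarrow> 'a set \<Rightarrow> 'a set" where
  "normal_cone P F = polar_cone (tangent_cone P F)"

definition faces_of_dim :: "nat \<Rightarrow> 'a::euclidean_space set \<Rightarrow> 'a set set" where
  "faces_of_dim j P = {F. F face_of P \<and> aff_dim F = int j}"

section \<open>Random walks\<close>

definition partial_sum :: "(nat \<Rightarrow> 'w \<Rightarrow> 'a::euclidean_space) \<Rightarrow> nat \<Rightarrow> 'w \<Rightarrow> 'a" where
  "partial_sum \<xi> i \<omega> = (\<Sum>k\<in>{1..i}. \<xi> k \<omega>)"

definition walk_hull :: "(nat \<Rightarrow> 'w \<Rightarrow> 'a::euclidean_space) \<Rightarrow> nat \<Rightarrow> 'w \<Rightarrow> 'a set" where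
  "walk_hull \<xi> n \<omega> = convex hull ((\<lambda>i. partial_sum \<xi> i \<omega>) ` {0..n})"

definition exchangeable :: "'w measure \<Rightarrow> nat \<Rightarrow> (nat \<Rightarrow> 'w \<Rightarrow> 'a::euclidean_space) \<Rightarrow> bool" where
  "exchangeable M n \<xi> \<longleftrightarrow>
     (\<forall>\<pi>. \<pi> permutes {1..n} \<longrightarrow>
        distr M (PiM {1..n} (\<lambda>_. borel)) (\<lambda>\<omega>. \<lambda>i\<in>{1..n}. \<xi> (\<pi> i) \<omega>) =
        distr M (PiM {1..n} (\<lambda>_. borel)) (\<lambda>\<omega>. \<lambda>i\<in>{1..n}. \<xi> i \<omega>))"

text \<open>
  Linear dependence of the indexed family \<open>(x i)\<close>, \<open>i \<in> I\<close>; unlike for \<open>dependent (x ` I)\<close>,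
  a family with a repeated vector is linearly dependent.
\<close>

definition dependent_family :: "'i set \<Rightarrow> ('i \<Rightarrow> 'a::real_vector) \<Rightarrow> bool" where
  "dependent_family I x \<longleftrightarrow> (\<exists>c. (\<exists>i\<in>I. c i \<noteq> 0) \<and> (\<Sum>i\<in>I. c i *\<^sub>R x i) = 0)"

text \<open>
  An index set \<open>I \<subseteq> {1..n}\<close> with \<open>d\<close> elements encodes \<open>1 \<le> i\<^sub>1 < \<dots> < i\<^sub>d \<le> n\<close>.
\<close>

definition general_position :: "'w measure \<Rightarrow> nat \<Rightarrow> (nat \<Rightarrow> 'w \<Rightarrow> 'a::euclidean_space) \<Rightarrow> bool" where
  "general_position M n \<xi> \<longleftrightarrow>
     (\<forall>I. I \<subseteq> {1..n} \<and> card I = DIM('a) \<longrightarrow>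
        (AE \<omega> in M. \<not> dependent_family I (\<lambda>i. partial_sum \<xi> i \<omega>)))"

section \<open>The definitions are meaningful\<close>

lemma tangent_cone_eq:
  fixes P :: "'a::euclidean_space set"
  assumes "convex P" "F face_of P" "f0 \<in> rel_interior F"
  shows "tangent_cone P F = {v. \<exists>\<epsilon>>0. f0 + \<epsilon> *\<^sub>R v \<in> P}"
proof (intro set_eqI iffI)
  fix v assume "v \<in> tangent_cone P F"
  then obtain f1 e where f1: "f1 \<in> rel_interior F" and e: "e > 0" "f1 + e *\<^sub>R v \<in> P"
    by (auto simp: tangent_cone_def)
  have cF: "convex F" "F \<subseteq> P"
    using assms by (auto simp: face_of_imp_convex face_of_imp_subset)
  have "f1 \<in> F" using f1 rel_interior_subset by blast
  then obtain m where m: "m > 1" "(1 - m) *\<^sub>R f1 + m *\<^sub>R f0 \<in> F"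
    using convex_rel_interior_if[OF cF(1) assms(3)] hull_subset[of F affine] by (metis order_refl subsetD)
  let ?g = "(1 - m) *\<^sub>R f1 + m *\<^sub>R f0"
  have "(1/m) *\<^sub>R ?g + (1 - 1/m) *\<^sub>R (f1 + e *\<^sub>R v) \<in> P"
    by (rule convexD[OF assms(1)]) (use m e cF in auto)
  also have "(1/m) *\<^sub>R ?g + (1 - 1/m) *\<^sub>R (f1 + e *\<^sub>R v)
      = ((1/m) * (1 - m) + (1 - 1/m)) *\<^sub>R f1 + ((1/m) * m) *\<^sub>R f0 + ((1 - 1/m) * e) *\<^sub>R v"
    by (simp only: scaleR_add_right scaleR_scaleR scaleR_add_left ac_simps)
  also have "\<dots> = f0 + ((1 - 1/m) * e) *\<^sub>R v"
    using m by (simp add: diff_divide_distrib)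
  finally show "v \<in> {v. \<exists>\<epsilon>>0. f0 + \<epsilon> *\<^sub>R v \<in> P}"
    using m e by (auto intro!: exI[of _ "(1 - 1/m) * e"])
next
  fix v assume "v \<in> {v. \<exists>\<epsilon>>0. f0 + \<epsilon> *\<^sub>R v \<in> P}"
  then show "v \<in> tangent_cone P F" using assms by (auto simp: tangent_cone_def)
qed

text \<open>
  Two Borel measures giving equal finite positive mass to all balls of equal radius with
  centres in a set of full measure coincide.
\<close>

lemma uniformly_distributed_open_le:
  fixes \<mu> \<nu> :: "'a::euclidean_space measure"
  assumes sets: "sets \<mu> = sets borel" "sets \<nu> = sets borel"
    and sf: "sigma_finite_measure \<mu>" "sigma_finite_measure \<nu>"
    and S: "AE x in \<mu>. x \<in> S" "AE x in \<nu>. x \<in> S"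
    and h: "\<And>x r. x \<in> S \<Longrightarrow> r > 0 \<Longrightarrow> emeasure \<mu> (ball x r) = h r"
           "\<And>x r. x \<in> S \<Longrightarrow> r > 0 \<Longrightarrow> emeasure \<nu> (ball x r) = h r"
           "\<And>r. r > 0 \<Longrightarrow> h r \<noteq> 0" "\<And>r. r > 0 \<Longrightarrow> h r \<noteq> \<infinity>"
    and U: "open U"
  shows "emeasure \<mu> U \<le> emeasure \<nu> U"
proof -
  interpret pair_sigma_finite \<mu> \<nu>
    using sf by (simp add: pair_sigma_finite_def)
  define r :: "nat \<Rightarrow> real" where "r k = 1 / (real k + 1)" for k
  have r: "r k > 0" for k by (simp add: r_def)
  define g :: "nat \<Rightarrow> 'a \<Rightarrow> 'a \<Rightarrow> ennreal"
    where "g k x y = indicator {z. fst z \<in> U \<and> snd z \<in> U \<and> dist (fst z) (snd z) < r k} (x, y) / h (r k)"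
    for k x y
  have spc: "space \<mu> = UNIV" "space \<nu> = UNIV"
    using sets[THEN sets_eq_imp_space_eq] by simp_all
  have setsP: "sets (\<mu> \<Otimes>\<^sub>M \<nu>) = sets borel"
    by (simp only: sets_pair_measure_cong[OF sets] borel_prod)
  have D: "open {z::'a\<times>'a. fst z \<in> U \<and> snd z \<in> U \<and> dist (fst z) (snd z) < r k}" (is "open (?D k)") for k
  proof -
    have "?D k = U \<times> U \<inter> {z. dist (fst z) (snd z) < r k}" by auto
    moreover have "open {z::'a\<times>'a. dist (fst z) (snd z) < r k}"
      by (intro open_Collect_less continuous_intros)
    ultimately show ?thesis using U by (auto intro!: open_Int open_Times)
  qed
  have gm: "case_prod (g k) \<in> borel_measurable (\<mu> \<Otimes>\<^sub>M \<nu>)" for k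
  proof -
    have "?D k \<in> sets (\<mu> \<Otimes>\<^sub>M \<nu>)" using D[of k] setsP by simp
    then have "(\<lambda>z. indicator (?D k) z / h (r k)) \<in> borel_measurable (\<mu> \<Otimes>\<^sub>M \<nu>)"
      by (intro borel_measurable_divide_ennreal borel_measurable_indicator) auto
    then show ?thesis unfolding g_def case_prod_beta' prod.collapse .
  qed
  have inner\<nu>: "(\<integral>\<^sup>+y. g k x y \<partial>\<nu>) = indicator U x * (emeasure \<nu> (U \<inter> ball x (r k)) / h (r k))" for k x
  proof -
    have "g k x y = indicator U x * (indicator (U \<inter> ball x (r k)) y / h (r k))" for y
      by (auto simp: g_def indicator_def dist_commute)
    moreover have "U \<inter> ball x (r k) \<in> sets \<nu>" using U sets by simp
    ultimately show ?thesis
      by (simp add: nn_integral_cmult nn_integral_divide del: ball_eq_empty)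
  qed
  have inner\<mu>: "(\<integral>\<^sup>+x. g k x y \<partial>\<mu>) = indicator U y * (emeasure \<mu> (U \<inter> ball y (r k)) / h (r k))" for k y
  proof -
    have "g k x y = indicator U y * (indicator (U \<inter> ball y (r k)) x / h (r k))" for x
      by (auto simp: g_def indicator_def dist_commute)
    moreover have "U \<inter> ball y (r k) \<in> sets \<mu>" using U sets by simp
    ultimately show ?thesis
      by (simp add: nn_integral_cmult nn_integral_divide del: ball_eq_empty)
  qed
  have le1: "(\<integral>\<^sup>+x. (\<integral>\<^sup>+y. g k x y \<partial>\<nu>) \<partial>\<mu>) \<le> emeasure \<nu> U" for k
  proof -
    have "(\<integral>\<^sup>+x. (\<integral>\<^sup>+y. g k x y \<partial>\<nu>) \<partial>\<mu>) = (\<integral>\<^sup>+y. (\<integral>\<^sup>+x. g k x y \<partial>\<mu>) \<partial>\<nu>)"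
      using Fubini'[OF gm] by simp
    also have "\<dots> \<le> (\<integral>\<^sup>+y. indicator U y \<partial>\<nu>)"
    proof (rule nn_integral_mono_AE, rule eventually_mono[OF S(2)])
      fix y assume "y \<in> S"
      have "emeasure \<mu> (U \<inter> ball y (r k)) \<le> h (r k)"
        using h(1)[OF \<open>y \<in> S\<close> r[of k]] sets by (metis Int_lower2 borel_open emeasure_mono open_ball)
      then have "emeasure \<mu> (U \<inter> ball y (r k)) / h (r k) \<le> 1"
        using h(3,4)[OF r[of k]] by (metis divide_right_mono_ennreal ennreal_divide_self infinity_ennreal_def top.not_eq_extremum zero_less_iff_neq_zero)
      then show "(\<integral>\<^sup>+x. g k x y \<partial>\<mu>) \<le> indicator U y"
        unfolding inner\<mu> by (auto simp: indicator_def)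
    qed
    also have "\<dots> = emeasure \<nu> U" using U sets by simp
    finally show ?thesis .
  qed
  have "emeasure \<mu> U = (\<integral>\<^sup>+x. indicator U x \<partial>\<mu>)" using U sets by simp
  also have "\<dots> \<le> (\<integral>\<^sup>+x. liminf (\<lambda>k. \<integral>\<^sup>+y. g k x y \<partial>\<nu>) \<partial>\<mu>)"
  proof (rule nn_integral_mono_AE, rule eventually_mono[OF S(1)])
    fix x assume "x \<in> S"
    show "indicator U x \<le> liminf (\<lambda>k. \<integral>\<^sup>+y. g k x y \<partial>\<nu>)"
    proof (cases "x \<in> U")
      case True
      then obtain e where e: "e > 0" "ball x e \<subseteq> U" using U openE by blast
      have "r \<longlonglongrightarrow> 0" unfolding r_def using LIMSEQ_inverse_real_of_nat by (simp add: inverse_eq_divide add.commute)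
      then have "eventually (\<lambda>k. r k < e) sequentially" using e order_tendstoD(2) by blast
      then have "eventually (\<lambda>k. 1 \<le> (\<integral>\<^sup>+y. g k x y \<partial>\<nu>)) sequentially"
      proof (rule eventually_mono)
        fix k assume "r k < e"
        then have "U \<inter> ball x (r k) = ball x (r k)" using e by (auto simp: subset_iff)
        then show "1 \<le> (\<integral>\<^sup>+y. g k x y \<partial>\<nu>)"
          unfolding inner\<nu> using True h(2)[OF \<open>x \<in> S\<close> r[of k]] h(3,4)[OF r[of k]]
          by (simp add: ennreal_divide_self top.not_eq_extremum zero_less_iff_neq_zero)
      qed
      then show ?thesis using True by (simp add: Liminf_bounded)
    qed auto
  qed
  also have "\<dots> \<le> liminf (\<lambda>k. \<integral>\<^sup>+x. (\<integral>\<^sup>+y. g k x y \<partial>\<nu>) \<partial>\<mu>)"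
    by (intro nn_integral_liminf M2.borel_measurable_nn_integral gm)
  also have "\<dots> \<le> emeasure \<nu> U"
    by (rule order_trans[OF Liminf_mono[OF always_eventually[rule_format, OF le1]]]) (simp add: Liminf_const)
  finally show ?thesis .
qed

lemma uniformly_distributed_unique:
  fixes \<mu> \<nu> :: "'a::euclidean_space measure"
  assumes sets: "sets \<mu> = sets borel" "sets \<nu> = sets borel"
    and fin: "\<And>n::nat. emeasure \<mu> (ball 0 n) \<noteq> \<infinity>" "\<And>n::nat. emeasure \<nu> (ball 0 n) \<noteq> \<infinity>"
    and S: "AE x in \<mu>. x \<in> S" "AE x in \<nu>. x \<in> S"
    and h: "\<And>x r. x \<in> S \<Longrightarrow> r > 0 \<Longrightarrow> emeasure \<mu> (ball x r) = h r"
           "\<And>x r. x \<in> S \<Longrightarrow> r > 0 \<Longrightarrow> emeasure \<nu> (ball x r) = h r"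
           "\<And>r. r > 0 \<Longrightarrow> h r \<noteq> 0" "\<And>r. r > 0 \<Longrightarrow> h r \<noteq> \<infinity>"
  shows "\<mu> = \<nu>"
proof -
  have spc: "space \<mu> = UNIV" "space \<nu> = UNIV"
    using sets[THEN sets_eq_imp_space_eq] by simp_all
  have cov: "(\<Union>n. ball (0::'a) (real n)) = UNIV"
    by (auto simp: reals_Archimedean2)
  have sf: "sigma_finite_measure \<mu>" "sigma_finite_measure \<nu>"
    by (auto intro!: sigma_finite_measure.intro exI[of _ "range (\<lambda>n::nat. ball 0 n)"]
        simp: sets spc cov fin[unfolded infinity_ennreal_def])
  show ?thesis
  proof (rule measure_eqI_generator_eq[where E = "{U. open U}" and \<Omega> = UNIV and A = "\<lambda>n::nat. ball 0 n"])
    fix X :: "'a set" assume X: "X \<in> {U. open U}"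
    have "emeasure \<mu> X \<le> emeasure \<nu> X"
      by (rule uniformly_distributed_open_le[OF sets sf S, of h]) (use h X in auto)
    moreover have "emeasure \<nu> X \<le> emeasure \<mu> X"
      by (rule uniformly_distributed_open_le[OF sets(2,1) sf(2,1) S(2,1), of h]) (use h X in auto)
    ultimately show "emeasure \<mu> X = emeasure \<nu> X" by simp
  qed (auto simp: Int_stable_def sets borel_def cov fin[unfolded infinity_ennreal_def])
qed

lemma borel_measurable_orthogonal:
  fixes f :: "'a::euclidean_space \<Rightarrow> 'a"
  shows "orthogonal_transformation f \<Longrightarrow> f \<in> borel_measurable borel"
  by (intro borel_measurable_continuous_onI linear_continuous_on)
     (simp add: orthogonal_transformation_linear linear_conv_bounded_linear[symmetric])

lemma uniform_on_sphere_unique: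
  fixes L :: "'a::euclidean_space set"
  assumes L: "subspace L" and \<mu>: "uniform_on_sphere L \<mu>" and \<nu>: "uniform_on_sphere L \<nu>"
  shows "\<mu> = \<nu>"
proof -
  let ?S = "sphere 0 1 \<inter> L"
  have cl: "closed ?S" using L by (auto intro: closed_subspace)
  have prob: "prob_space \<mu>" "prob_space \<nu>" and sets: "sets \<mu> = sets borel" "sets \<nu> = sets borel"
    using \<mu> \<nu> by (auto simp: uniform_on_sphere_def)
  interpret \<mu>: prob_space \<mu> by fact
  interpret \<nu>: prob_space \<nu> by fact
  interpret pair_sigma_finite \<mu> \<nu> ..
  have spc: "space \<mu> = UNIV" "space \<nu> = UNIV"
    using sets[THEN sets_eq_imp_space_eq] by simp_all
  have S: "AE x in \<mu>. x \<in> ?S" "AE x in \<nu>. x \<in> ?S"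
    using \<mu> \<nu> by (auto simp only: uniform_on_sphere_def intro!: \<mu>.AE_prob_1 \<nu>.AE_prob_1)
  have const: "emeasure \<kappa> (ball x r) = emeasure \<kappa> (ball y r)"
    if \<kappa>: "uniform_on_sphere L \<kappa>" and xy: "x \<in> ?S" "y \<in> ?S" for \<kappa> x y r
  proof (cases "x = y")
    case False
    define a where "a = x - y"
    have a: "a \<noteq> 0" "a \<in> L" using False xy L by (auto simp: a_def subspace_diff)
    define f where "f z = z - (2 * (z \<bullet> a) / (a \<bullet> a)) *\<^sub>R a" for z
    have lin: "linear f" unfolding f_def
      by (rule linearI) (auto simp: algebra_simps inner_add_left add_divide_distrib scaleR_add_left)
    have inn: "f z \<bullet> f w = z \<bullet> w" for z w
      using a by (simp add: f_def inner_diff_left inner_diff_right inner_commute field_simps)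
    have ot: "orthogonal_transformation f"
      using lin inn by (auto simp: orthogonal_transformation_def)
    have ff: "f (f z) = z" for z
      using a by (simp add: f_def inner_diff_left field_simps flip: scaleR_left_distrib scaleR_left_diff_distrib)
    have fL: "f z \<in> L" if "z \<in> L" for z
      using that a L by (simp add: f_def subspace_diff subspace_scale)
    have im: "f ` L = L" using fL ff by (metis image_eqI image_subsetI subsetI subset_antisym)
    have aa: "a \<bullet> a = 2 * (x \<bullet> a)"
      using xy by (simp add: a_def inner_diff_left inner_diff_right inner_commute[of y x] norm_eq_1)
    have fx: "f x = y"
    proof -
      have k: "2 * (x \<bullet> a) / (a \<bullet> a) = 1" using aa a by (metis divide_self inner_eq_zero_iff)
      have "f x = x - a" unfolding f_def k by simp
      then show ?thesis by (simp add: a_def)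
    qed
    have fm: "f \<in> borel_measurable borel"
      using ot by (simp add: borel_measurable_orthogonal)
    have d: "distr \<kappa> borel f = \<kappa>" and sk: "sets \<kappa> = sets borel"
      using \<kappa> ot im by (auto simp: uniform_on_sphere_def)
    have fm': "f \<in> measurable \<kappa> borel" using fm sk by (simp cong: measurable_cong_sets)
    have "emeasure \<kappa> (ball y r) = emeasure (distr \<kappa> borel f) (ball y r)" using d by simp
    also have "\<dots> = emeasure \<kappa> (f -` ball y r \<inter> space \<kappa>)" using fm' by (simp add: emeasure_distr)
    also have "f -` ball y r \<inter> space \<kappa> = ball x r"
    proof -
      have "dist y (f z) = dist x z" for z
        using ot fx orthogonal_transformation_isometry[of f] by metis
      moreover have "space \<kappa> = UNIV" using sets_eq_imp_space_eq[OF sk] by simp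
      ultimately show ?thesis by auto
    qed
    finally show ?thesis by simp
  qed simp
  have "?S \<noteq> {}"
  proof
    assume e: "?S = {}"
    from \<mu> have "measure \<mu> ?S = 1" by (simp add: uniform_on_sphere_def)
    then show False unfolding e by simp
  qed
  then obtain x0 where x0: "x0 \<in> ?S" by blast
  define h where "h r = emeasure \<mu> (ball x0 r)" for r
  have h\<mu>: "emeasure \<mu> (ball x r) = h r" if "x \<in> ?S" for x r
    unfolding h_def by (rule const[OF \<mu> that x0])
  have h\<nu>: "emeasure \<nu> (ball x r) = h r" if x: "x \<in> ?S" for x r
  proof -
    let ?D = "{z::'a\<times>'a. dist (fst z) (snd z) < r}"
    have D: "open ?D" by (intro open_Collect_less continuous_intros)
    have "sets (\<mu> \<Otimes>\<^sub>M \<nu>) = sets borel"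
      by (simp only: sets_pair_measure_cong[OF sets] borel_prod)
    then have m: "case_prod (\<lambda>x y. indicator ?D (x, y) :: ennreal) \<in> borel_measurable (\<mu> \<Otimes>\<^sub>M \<nu>)"
      using borel_open[OF D] unfolding case_prod_beta' prod.collapse
      by (intro borel_measurable_indicator) simp
    have i: "indicator ?D (x, y) = (indicator (ball x r) y :: ennreal)"
            "indicator ?D (x, y) = (indicator (ball y r) x :: ennreal)" for x y
      by (auto simp: indicator_def dist_commute)
    have "h r = (\<integral>\<^sup>+y. h r \<partial>\<nu>)" by (simp add: \<nu>.emeasure_space_1)
    also have "\<dots> = (\<integral>\<^sup>+y. emeasure \<mu> (ball y r) \<partial>\<nu>)"
      by (rule nn_integral_cong_AE, rule eventually_mono[OF S(2)]) (simp add: h\<mu>)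
    also have "\<dots> = (\<integral>\<^sup>+y. \<integral>\<^sup>+x. indicator ?D (x, y) \<partial>\<mu> \<partial>\<nu>)"
      unfolding i(2) using sets by simp
    also have "\<dots> = (\<integral>\<^sup>+x. \<integral>\<^sup>+y. indicator ?D (x, y) \<partial>\<nu> \<partial>\<mu>)"
      by (rule Fubini'[OF m])
    also have "\<dots> = (\<integral>\<^sup>+z. emeasure \<nu> (ball z r) \<partial>\<mu>)"
      unfolding i(1) using sets by simp
    also have "\<dots> = (\<integral>\<^sup>+z. emeasure \<nu> (ball x r) \<partial>\<mu>)"
      by (rule nn_integral_cong_AE, rule eventually_mono[OF S(1)]) (simp add: const[OF \<nu> _ x])
    also have "\<dots> = emeasure \<nu> (ball x r)" by (simp add: \<mu>.emeasure_space_1)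
    finally show ?thesis by simp
  qed
  have h0: "h r \<noteq> 0" if r: "r > 0" for r
  proof
    assume 0: "h r = 0"
    have "compact ?S" using cl by (metis closed_Int_compact compact_sphere L closed_subspace Int_commute)
    then obtain C where C: "finite C" "C \<subseteq> ?S" "?S \<subseteq> (\<Union>c\<in>C. ball c r)"
      by (rule compactE_image[of ?S ?S "\<lambda>x. ball x r"]) (use r in auto)
    have "emeasure \<mu> ?S \<le> emeasure \<mu> (\<Union>c\<in>C. ball c r)"
      by (rule emeasure_mono[OF C(3)]) (use C sets in auto)
    also have "\<dots> \<le> (\<Sum>c\<in>C. emeasure \<mu> (ball c r))"
      by (rule emeasure_subadditive_finite) (use C sets in auto)
    also have "\<dots> = (\<Sum>c\<in>C. h r)" by (rule sum.cong) (use C(2) h\<mu> in blast)+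
    also have "\<dots> = 0" using 0 by simp
    finally have "measure \<mu> ?S = 0" by (simp add: measure_def)
    then show False using \<mu> by (simp add: uniform_on_sphere_def)
  qed
  show ?thesis
    by (rule uniformly_distributed_unique[OF sets _ _ S, of h])
       (use h\<mu> h\<nu> h0 in \<open>auto simp: h_def\<close>)
qed

lemma distr_lborel_orthogonal:
  fixes f :: "'a::euclidean_space \<Rightarrow> 'a"
  assumes f: "orthogonal_transformation f"
  shows "distr lborel borel f = lborel"
proof -
  have fm: "f \<in> borel_measurable borel"
    using f by (simp add: borel_measurable_orthogonal)
  have b: "emeasure (distr lborel borel f) (ball x r) = emeasure lborel (ball (0::'a) r)" for x r
  proof -
    obtain x' where x': "f x' = x" using orthogonal_transformation_surj[OF f] by (metis surjD)
    have "f -` ball x r = ball x' r"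
      using f x' orthogonal_transformation_isometry[of f] by (auto simp: vimage_def)
    then have "emeasure (distr lborel borel f) (ball x r) = emeasure lborel (ball x' r)"
      using fm by (simp add: emeasure_distr)
    also have "\<dots> = emeasure lborel (ball (0::'a) r)"
      by (cases "r \<ge> 0") (simp_all add: emeasure_ball ball_empty)
    finally show ?thesis .
  qed
  have fin: "emeasure lborel (ball x r) \<noteq> \<infinity>" for x :: 'a and r
    by (metis emeasure_lborel_ball_finite infinity_ennreal_def less_irrefl)
  have eq: "emeasure lborel (ball x r) = emeasure lborel (ball (0::'a) r)" for x :: 'a and r
    by (cases "r \<ge> 0") (simp_all add: emeasure_ball ball_empty)
  have pos: "emeasure lborel (ball (0::'a) r) \<noteq> 0" if "r > 0" for r
    using that by (simp add: emeasure_ball unit_ball_vol_pos less_imp_le ennreal_eq_0_iff not_le)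
  show ?thesis
    by (rule uniformly_distributed_unique[where S = UNIV and h = "\<lambda>r. emeasure lborel (ball (0::'a) r)"])
       (use b fin eq pos in auto)
qed

text \<open>
  Existence: normalise the orthogonal projection onto \<open>L\<close> of a uniform point of the unit ball.
\<close>

lemma uniform_on_sphere_exists:
  fixes L :: "'a::euclidean_space set"
  assumes L: "subspace L" and nz: "L \<noteq> {0}"
  shows "\<exists>\<mu>. uniform_on_sphere L \<mu>"
proof -
  define B where "B = uniform_measure lborel (ball (0::'a) 1)"
  define p where "p = (closest_point L :: 'a \<Rightarrow> 'a)"
  define q where "q x = sgn (p x)" for x
  have cl: "closed L" "convex L" "L \<noteq> {}"
    using L subspace_0[OF L] by (auto simp: closed_subspace subspace_imp_convex)
  have e1: "emeasure lborel (ball (0::'a) 1) \<noteq> 0" "emeasure lborel (ball (0::'a) 1) \<noteq> \<infinity>"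
    by (auto simp: emeasure_ball unit_ball_vol_pos ennreal_eq_0_iff not_le)
  have sB: "sets B = sets borel" "space B = UNIV" by (auto simp: B_def)
  interpret B: prob_space B
    unfolding B_def using e1 by (intro prob_space_uniform_measure) auto
  have pc: "continuous_on UNIV p"
    unfolding p_def using cl by (intro continuous_on_closest_point) auto
  have qm: "q \<in> borel_measurable borel"
    unfolding q_def sgn_div_norm[abs_def] using borel_measurable_continuous_onI[OF pc] by measurable
  have qmB: "q \<in> measurable B borel" using qm sB by (simp cong: measurable_cong_sets)
  have pL: "p x \<in> L" for x unfolding p_def using cl by (intro closest_point_in_set) auto
  have qS: "q x \<in> sphere 0 1 \<inter> L" if "p x \<noteq> 0" for x
    using that pL[of x] L by (auto simp: q_def norm_sgn sgn_div_norm subspace_scale)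
  have orth: "x \<bullet> v = 0" if "p x = 0" "v \<in> L" for x v
  proof -
    have "(x - 0) \<bullet> (u - 0) \<le> 0" if "u \<in> L" for u
      using closest_point_dot[OF cl(2,1) that, of x] \<open>p x = 0\<close> unfolding p_def by simp
    from this[OF \<open>v \<in> L\<close>] this[of "- v"] show ?thesis
      using \<open>v \<in> L\<close> L by (simp add: subspace_neg)
  qed
  obtain v where v: "v \<in> L" "v \<noteq> 0" using nz cl(3) by blast
  have "negligible {x. p x = 0}"
  proof (rule negligible_subset)
    show "negligible {x. v \<bullet> x = 0}" using v by (intro negligible_hyperplane) auto
    show "{x. p x = 0} \<subseteq> {x. v \<bullet> x = 0}" using orth v by (auto simp: inner_commute)
  qed
  moreover have bs: "{x. p x = 0} \<in> sets borel"
    using pc by (intro borel_closed closed_Collect_eq) auto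
  ultimately have "{x. p x = 0} \<in> null_sets lborel"
    by (simp add: negligible_iff_null_sets null_sets_completion_iff)
  then have "AE x in lborel. p x \<noteq> 0" using AE_not_in by fastforce
  then have AEB: "AE x in B. p x \<noteq> 0"
    unfolding B_def by (intro AE_uniform_measureI) auto
  have pf: "p (f x) = f (p x)" if f: "orthogonal_transformation f" "f ` L = L" for f x
  proof -
    have "\<forall>z\<in>L. dist (f x) (f (p x)) \<le> dist (f x) z"
    proof
      fix z assume "z \<in> L"
      then obtain z' where z': "z' \<in> L" "z = f z'" using f by blast
      have "dist x (p x) \<le> dist x z'"
        unfolding p_def using cl z' by (intro closest_point_le) auto
      then show "dist (f x) (f (p x)) \<le> dist (f x) z"
        using z' f(1) orthogonal_transformation_isometry[of f] by simp
    qed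
    then show ?thesis
      unfolding p_def using pL[of x] f cl
      by (intro closest_point_unique[symmetric]) (auto simp: p_def)
  qed
  have qf: "q (f x) = f (q x)" if f: "orthogonal_transformation f" "f ` L = L" for f x
    using f orthogonal_transformation_norm[OF f(1)] orthogonal_transformation_scaleR[OF f(1)]
    by (simp add: q_def pf sgn_div_norm)
  have Binv: "distr B borel f = B" if f: "orthogonal_transformation f" for f
  proof (rule measure_eqI)
    show "sets (distr B borel f) = sets B" by (simp add: sB)
    fix A assume "A \<in> sets (distr B borel f)"
    then have A: "A \<in> sets borel" by simp
    have fm: "f \<in> borel_measurable borel"
      using f by (simp add: borel_measurable_orthogonal)
    have fA: "f -` A \<in> sets borel" using measurable_sets[OF fm A] by simp
    have "emeasure (distr B borel f) A = emeasure B (f -` A)"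
      using fm A sB by (simp add: emeasure_distr cong: measurable_cong_sets)
    also have "\<dots> = emeasure lborel (ball 0 1 \<inter> f -` A) / emeasure lborel (ball (0::'a) 1)"
      unfolding B_def using fA by simp
    also have "ball 0 1 \<inter> f -` A = f -` (ball 0 1 \<inter> A)"
      using orthogonal_transformation_norm[OF f] by auto
    also have "emeasure lborel (f -` (ball 0 1 \<inter> A)) = emeasure (distr lborel borel f) (ball 0 1 \<inter> A)"
      using fm A by (simp add: emeasure_distr)
    also have "\<dots> / emeasure lborel (ball (0::'a) 1) = emeasure B A"
      unfolding B_def distr_lborel_orthogonal[OF f] using A by simp
    finally show "emeasure (distr B borel f) A = emeasure B A" .
  qed
  have "uniform_on_sphere L (distr B borel q)"
    unfolding uniform_on_sphere_def
  proof (intro conjI allI impI)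
    show "prob_space (distr B borel q)" using qmB by (rule B.prob_space_distr)
    have "closed (sphere 0 1 \<inter> L)" using cl by auto
    then have m: "sphere 0 1 \<inter> L \<in> sets borel" by (rule borel_closed)
    have "measure (distr B borel q) (sphere 0 1 \<inter> L) = measure B (q -` (sphere 0 1 \<inter> L) \<inter> space B)"
      using qmB m by (rule measure_distr)
    also have "\<dots> = 1"
    proof (subst B.prob_eq_1)
      show "q -` (sphere 0 1 \<inter> L) \<inter> space B \<in> sets B" using qmB m by (rule measurable_sets)
      show "AE x in B. x \<in> q -` (sphere 0 1 \<inter> L) \<inter> space B"
        using AEB by (rule eventually_mono) (use qS sB in auto)
    qed
    finally show "measure (distr B borel q) (sphere 0 1 \<inter> L) = 1" .
    fix f assume f: "orthogonal_transformation f \<and> f ` L = L"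
    have fm: "f \<in> borel_measurable borel"
      using f by (simp add: borel_measurable_orthogonal)
    have fmB: "f \<in> measurable B borel" using fm sB by (simp cong: measurable_cong_sets)
    have "distr (distr B borel q) borel f = distr B borel (f \<circ> q)"
      using fm qmB by (rule distr_distr)
    also have "f \<circ> q = q \<circ> f" using f qf by auto
    also have "distr B borel (q \<circ> f) = distr (distr B borel f) borel q"
      using qm fmB by (rule distr_distr[symmetric])
    also have "\<dots> = distr B borel q" using Binv f by simp
    finally show "distr (distr B borel q) borel f = distr B borel q" .
  qed simp
  then show ?thesis ..
qed

lemma uniform_on_sphere_uniform_sphere:
  fixes L :: "'a::euclidean_space set"
  assumes "subspace L" "L \<noteq> {0}"
  shows "uniform_on_sphere L (uniform_sphere L)"
  unfolding uniform_sphere_def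
  using uniform_on_sphere_exists[OF assms] uniform_on_sphere_unique[OF assms(1)]
  by (metis theI')

end

theory Submission
  imports Defs "HOL-Combinatorics.Multiset_Permutations"
begin

text \<open>
  The angle \<open>\<alpha>(N\<^sub>F)\<close> of the normal cone at a \<open>j\<close>-face \<open>F\<close> is the probability that the projection of a
  uniform point \<open>u\<close> of the unit ball to the orthogonal complement of \<open>F\<close> attains its maximum over
  the polytope on \<open>F\<close>. Hence, for points \<open>s\<^sub>0, \<dots>, s\<^sub>n\<close> in any position, the angle sum is a sum over
  index sets \<open>J\<close> with \<open>dim aff {s\<^sub>k | k \<in> J} = j\<close>: the term of \<open>J\<close> is the probability that the
  projection of \<open>u\<close> to the space of directions that are constant on \<open>{s\<^sub>k | k \<in> J}\<close> is strictly
  larger there than at all other points (\<open>sum_solid_angle_eq_sum_direction_prob\<close>). Gram-Schmidt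
  orthogonalisation shows that this expression is a measurable function of the points, degenerate
  configurations included.

  By exchangeability the expectation does not change when the steps are reordered, so it equals the
  average over all \<open>n!\<close> orderings of the steps. It is therefore enough to prove a deterministic
  statement: for generic steps, the angle sums of all \<open>n!\<close> reordered walks add up to
  \<open>j! [n+1, j+1]\<close> (\<open>sum_permutations_direction_prob\<close>). Genericity of almost every realisation follows
  from the general position assumption, applied to all reordered walks. Interchanging the sum with
  the integral over \<open>u\<close>, one has to count, for almost every fixed \<open>u\<close>, the pairs of an ordering and
  a set \<open>J\<close> of \<open>j + 1\<close> times for which the strict inequalities hold (\<open>card_strict_index_sets\<close>).

  The times in \<open>J\<close> cut the ordering into a head, \<open>j\<close> blocks and a tail. The projected direction is
  orthogonal to the block sums and depends on nothing else than these sums, so it is not affected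
  by reordering the steps inside a block. Along this direction every block is a bridge that
  starts and ends at the common level of the cut times. The conditions on the individual pieces are
  now independent:

  \<^item> Of the \<open>l!\<close> orderings of a block of \<open>l\<close> steps exactly \<open>(l - 1)!\<close> stay strictly below this
    level, because precisely one cyclic shift of a bridge does (\<open>card_negative_bridges\<close>).

  \<^item> The \<open>m\<close> steps outside the blocks contribute \<open>m!\<close>, because every ordering of them has exactly one
    admissible cut into head and tail, namely at its strict maximum (\<open>card_head_tail_splits\<close>).

  The number of pairs is thus the sum of \<open>m! \<Prod> (l\<^sub>i - 1)!\<close> over all ordered families of \<open>j\<close> disjoint
  nonempty blocks. Reading \<open>(l - 1)!\<close> as the number of cycles on a block and \<open>m!\<close> as the number of
  ways to complete the remaining \<open>m\<close> elements and a new point to a cycle, this is \<open>j!\<close> times the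
  number of permutations of \<open>n + 1\<close> elements with \<open>j + 1\<close> cycles (\<open>sum_over_block_lists\<close>).
\<close>

section \<open>Orthogonal projection onto a subspace and solid angles\<close>

lemma closest_point_subspace_iff:
  fixes W :: "'a::euclidean_space set"
  assumes W: "subspace W"
  shows "closest_point W u = v \<longleftrightarrow> v \<in> W \<and> (\<forall>w\<in>W. (u - v) \<bullet> w = 0)"
proof -
  define p where "p = closest_point W u"
  have W': "convex W" "closed W" "W \<noteq> {}"
    using W subspace_0[OF W] by (auto simp: subspace_imp_convex closed_subspace)
  have p: "p \<in> W" unfolding p_def using W' by (intro closest_point_in_set)
  have orth: "(u - p) \<bullet> w = 0" if "w \<in> W" for w
  proof -
    have "(u - p) \<bullet> ((p + c *\<^sub>R w) - p) \<le> 0" for c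
      unfolding p_def using W' W p that
      by (intro closest_point_dot) (auto simp: p_def subspace_add subspace_scale)
    from this[of 1] this[of "-1"] show ?thesis by simp
  qed
  have "v = p" if v: "v \<in> W" "\<forall>w\<in>W. (u - v) \<bullet> w = 0"
  proof -
    have "v - p \<in> W" using v p W by (simp add: subspace_diff)
    then have "(u - p) \<bullet> (v - p) - (u - v) \<bullet> (v - p) = 0" using orth v by simp
    then have "(v - p) \<bullet> (v - p) = 0" by (simp flip: inner_diff_left)
    then show ?thesis by simp
  qed
  then show ?thesis using p orth unfolding p_def by blast
qed

lemma
  fixes W :: "'a::euclidean_space set"
  assumes W: "subspace W"
  shows closest_point_subspace_in: "closest_point W u \<in> W"
    and closest_point_subspace_orth: "w \<in> W \<Longrightarrow> closest_point W u \<bullet> w = u \<bullet> w"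
    and closest_point_subspace_selfadjoint: "closest_point W u \<bullet> y = u \<bullet> closest_point W y"
proof -
  have 1: "closest_point W u \<in> W" "\<And>w. w \<in> W \<Longrightarrow> closest_point W u \<bullet> w = u \<bullet> w" for u
    using closest_point_subspace_iff[OF W, of u "closest_point W u"]
    by (simp_all add: inner_diff_left)
  show "closest_point W u \<in> W" "w \<in> W \<Longrightarrow> closest_point W u \<bullet> w = u \<bullet> w" by fact+
  show "closest_point W u \<bullet> y = u \<bullet> closest_point W y"
    using 1(2)[of "closest_point W u" y] 1(2)[of "closest_point W y" u] 1(1)
    by (simp add: inner_commute)
qed

lemma continuous_on_closest_point_subspace:
  fixes W :: "'a::euclidean_space set"
  assumes W: "subspace W"
  shows "continuous_on UNIV (closest_point W)"
  using W subspace_0[OF W]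
  by (intro continuous_on_closest_point) (auto simp: subspace_imp_convex closed_subspace)

text \<open>
  A rotation invariant law from which the uniform law on the sphere of every subspace is obtained by
  projecting and normalising. The ball is preferred to the sphere because hyperplanes are null
  sets simply by absolute continuity.
\<close>

definition ball_measure :: "'a::euclidean_space measure" where
  "ball_measure = uniform_measure lborel (ball 0 1)"

lemma sets_ball_measure [simp, measurable_cong]: "sets ball_measure = sets borel"
  and space_ball_measure [simp]: "space ball_measure = UNIV"
  by (auto simp: ball_measure_def)

lemma prob_space_ball_measure: "prob_space (ball_measure :: 'a::euclidean_space measure)"
  unfolding ball_measure_def
  by (intro prob_space_uniform_measure)
     (auto simp: emeasure_ball unit_ball_vol_pos ennreal_eq_0_iff not_le)

interpretation ball_measure: prob_space ball_measure by (rule prob_space_ball_measure)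

lemma distr_ball_measure_orthogonal:
  fixes f :: "'a::euclidean_space \<Rightarrow> 'a"
  assumes f: "orthogonal_transformation f"
  shows "distr ball_measure borel f = ball_measure"
proof (rule measure_eqI)
  fix A assume "A \<in> sets (distr ball_measure borel f)"
  then have A: "A \<in> sets borel" by simp
  have fm [measurable]: "f \<in> borel_measurable borel"
    using f by (rule borel_measurable_orthogonal)
  have fA: "f -` A \<in> sets borel" using measurable_sets[OF fm A] by simp
  have "ball 0 1 \<inter> f -` A = f -` (ball 0 1 \<inter> A)"
    using orthogonal_transformation_norm[OF f] by auto
  moreover have "emeasure lborel (f -` (ball 0 1 \<inter> A)) = emeasure (distr lborel borel f) (ball 0 1 \<inter> A)"
    using A by (simp add: emeasure_distr)
  ultimately show "emeasure (distr ball_measure borel f) A = emeasure ball_measure A"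
    using A fA by (simp add: emeasure_distr ball_measure_def distr_lborel_orthogonal[OF f])
qed simp

lemma AE_ball_measure_inner_nonzero:
  fixes y :: "'a::euclidean_space"
  assumes "y \<noteq> 0"
  shows "AE u in ball_measure. u \<bullet> y \<noteq> 0"
proof -
  have "negligible {u. y \<bullet> u = 0}" using assms by (intro negligible_hyperplane) auto
  moreover have "{u. y \<bullet> u = 0} \<in> sets borel"
    by (intro borel_closed closed_Collect_eq continuous_intros)
  ultimately have "{u. y \<bullet> u = 0} \<in> null_sets lborel"
    by (simp add: negligible_iff_null_sets null_sets_completion_iff)
  then have "AE u in lborel. u \<bullet> y \<noteq> 0"
    using AE_not_in by (fastforce simp: inner_commute)
  then show ?thesis
    unfolding ball_measure_def by (intro AE_uniform_measureI) auto
qed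

text \<open>
  Projection onto \<open>W\<close> commutes with every rotation that preserves \<open>W\<close>, so the normalised projection
  of a uniform point of the ball is uniform on the sphere of \<open>W\<close>. Since \<open>C\<close> is a cone,
  normalising does not change membership in it.
\<close>

lemma solid_angle_eq_ball_measure:
  fixes W C :: "'a::euclidean_space set"
  assumes W: "subspace W" "W \<noteq> {0}" and C: "span C = W" "C \<in> sets borel"
    and cone: "\<And>c x. c > 0 \<Longrightarrow> x \<in> C \<Longrightarrow> c *\<^sub>R x \<in> C"
  shows "solid_angle C = measure ball_measure {u. closest_point W u \<in> C}"
proof (cases "subspace C")
  case True
  then have "C = W" using C by (metis span_eq_iff)
  then have "{u. closest_point W u \<in> C} = UNIV" by (auto simp: closest_point_subspace_in[OF W(1)])
  then show ?thesis
    using True ball_measure.prob_space by (simp add: solid_angle_def)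
next
  case False
  define p where "p = closest_point W"
  define q where "q u = sgn (p u)" for u
  note pW = closest_point_subspace_in[OF W(1), folded p_def]
  have cW: "closed W" using W by (simp add: closed_subspace)
  have [measurable]: "p \<in> borel_measurable borel"
    unfolding p_def by (intro borel_measurable_continuous_onI continuous_on_closest_point_subspace W)
  have qm [measurable]: "q \<in> borel_measurable borel"
    unfolding q_def sgn_div_norm[abs_def] by measurable
  obtain v where v: "v \<in> W" "v \<noteq> 0" using W subspace_0[OF W(1)] by blast
  have p0: "AE u in ball_measure. p u \<noteq> 0"
    using AE_ball_measure_inner_nonzero[OF v(2)]
  proof eventually_elim
    case (elim u)
    then show ?case
      using closest_point_subspace_orth[OF W(1) v(1), of u] by (auto simp: p_def)
  qed
  have qS: "q u \<in> sphere 0 1 \<inter> W" if "p u \<noteq> 0" for u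
    using that pW[of u] W by (auto simp: q_def norm_sgn sgn_div_norm subspace_scale)
  have pf: "p (f u) = f (p u)" if f: "orthogonal_transformation f" "f ` W = W" for f u
    unfolding p_def closest_point_subspace_iff[OF W(1)]
  proof (intro conjI ballI)
    show "f (closest_point W u) \<in> W" using f(2) pW[of u] by (auto simp: p_def)
    fix w assume "w \<in> W"
    then obtain w' where w': "w' \<in> W" "w = f w'" using f(2) by blast
    have "(f u - f (p u)) \<bullet> f w' = (u - p u) \<bullet> w'"
      using f(1) by (metis linear_diff orthogonal_transformation_def)
    also have "\<dots> = 0"
      using closest_point_subspace_orth[OF W(1) w'(1), of u] by (simp add: inner_diff_left p_def)
    finally show "(f u - f (closest_point W u)) \<bullet> w = 0" by (simp add: w' p_def)
  qed
  have qf: "q (f u) = f (q u)" if f: "orthogonal_transformation f" "f ` W = W" for f u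
    using f orthogonal_transformation_norm[OF f(1)] orthogonal_transformation_scaleR[OF f(1)]
    by (simp add: q_def pf sgn_div_norm)
  have "uniform_on_sphere W (distr ball_measure borel q)"
    unfolding uniform_on_sphere_def
  proof (intro conjI allI impI)
    show "prob_space (distr ball_measure borel q)"
      by (rule ball_measure.prob_space_distr) simp
    have m: "sphere 0 1 \<inter> W \<in> sets borel" using cW by (intro borel_closed) auto
    have "AE u in ball_measure. q u \<in> sphere 0 1 \<inter> W"
      using p0 by eventually_elim (rule qS)
    then have "measure ball_measure {u. q u \<in> sphere 0 1 \<inter> W} = 1"
      using m measurable_sets[OF qm m] by (subst ball_measure.prob_eq_1) (auto simp: vimage_def)
    then show "measure (distr ball_measure borel q) (sphere 0 1 \<inter> W) = 1"
      using m by (simp add: measure_distr vimage_def)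
    fix f assume f: "orthogonal_transformation f \<and> f ` W = W"
    then have [measurable]: "f \<in> borel_measurable borel"
      by (simp add: borel_measurable_orthogonal)
    have "distr (distr ball_measure borel q) borel f = distr ball_measure borel (q \<circ> f)"
      using qf f by (subst distr_distr) (auto simp: comp_def)
    also have "\<dots> = distr (distr ball_measure borel f) borel q"
      by (subst distr_distr) auto
    finally show "distr (distr ball_measure borel q) borel f = distr ball_measure borel q"
      using f by (simp add: distr_ball_measure_orthogonal)
  qed simp
  then have u: "uniform_sphere W = distr ball_measure borel q"
    using uniform_on_sphere_unique[OF W(1)] uniform_on_sphere_uniform_sphere[OF W] by blast
  have "q u \<in> C \<longleftrightarrow> p u \<in> C" for u
  proof (cases "p u = 0")
    case pu: False
    have "p u \<in> C" if "q u \<in> C"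
      using cone[OF _ that, of "norm (p u)"] pu by (simp add: q_def sgn_div_norm)
    moreover have "q u \<in> C" if "p u \<in> C"
      using cone[OF _ that, of "inverse (norm (p u))"] pu by (simp add: q_def sgn_div_norm)
    ultimately show ?thesis by blast
  qed (auto simp: q_def)
  then have "measure (distr ball_measure borel q) C = measure ball_measure {u. p u \<in> C}"
    using C by (simp add: measure_distr vimage_def)
  then show ?thesis using False C by (simp add: solid_angle_def u p_def)
qed

section \<open>Faces and normal cones of the hull of an indexed family\<close>

text \<open>
  For points \<open>s i\<close> this is the orthogonal complement of the linear space parallel to the affine hull
  of \<open>{s i | i \<in> J}\<close>.
\<close>

definition level_space :: "('i \<Rightarrow> 'a::euclidean_space) \<Rightarrow> 'i set \<Rightarrow> 'a set" where
  "level_space s J = {w. \<forall>i\<in>J. \<forall>k\<in>J. w \<bullet> s i = w \<bullet> s k}"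

definition weak_maximizers :: "('i \<Rightarrow> 'a::euclidean_space) \<Rightarrow> 'i set \<Rightarrow> 'i set \<Rightarrow> 'a set" where
  "weak_maximizers s N J = {w. \<forall>i\<in>N. \<forall>k\<in>J. w \<bullet> s i \<le> w \<bullet> s k}"

definition strict_maximizers :: "('i \<Rightarrow> 'a::euclidean_space) \<Rightarrow> 'i set \<Rightarrow> 'i set \<Rightarrow> 'a set" where
  "strict_maximizers s N J = {w. \<forall>i\<in>N - J. \<forall>k\<in>J. w \<bullet> s i < w \<bullet> s k}"

lemma subspace_level_space: "subspace (level_space s J)"
proof -
  have "level_space s J = (\<Inter>i\<in>J. \<Inter>k\<in>J. {w. (s i - s k) \<bullet> w = 0})"
    by (auto simp: level_space_def inner_diff_right inner_commute)
  then show ?thesis by (auto intro!: subspace_Inter simp: subspace_hyperplane)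
qed

lemma level_spaceI: "(\<And>i. i \<in> J \<Longrightarrow> w \<bullet> s i = c) \<Longrightarrow> w \<in> level_space s J"
  by (simp add: level_space_def)

lemma level_spaceD: "w \<in> level_space s J \<Longrightarrow> i \<in> J \<Longrightarrow> k \<in> J \<Longrightarrow> w \<bullet> (s i - s k) = 0"
  unfolding level_space_def inner_diff_right right_minus_eq by blast

lemma level_space_nontrivial:
  fixes s :: "'i \<Rightarrow> 'a::euclidean_space"
  assumes "aff_dim (s ` J) < int DIM('a)"
  shows "level_space s J \<noteq> {0}"
proof -
  obtain a b where "a \<noteq> 0" "s ` J \<subseteq> {x. a \<bullet> x = b}"
    using aff_lowdim_subset_hyperplane[OF assms] by metis
  then have "a \<in> level_space s J" by (auto simp: level_space_def image_subset_iff)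
  with \<open>a \<noteq> 0\<close> show ?thesis by auto
qed

lemma convex_hull_image_inner_le:
  assumes "x \<in> convex hull (s ` N)" "\<And>i. i \<in> N \<Longrightarrow> a \<bullet> s i \<le> b"
  shows "a \<bullet> x \<le> b"
proof -
  have "convex hull (s ` N) \<subseteq> {x. a \<bullet> x \<le> b}"
    using assms(2) by (intro hull_minimal convex_halfspace_le) auto
  with assms(1) show ?thesis by blast
qed

lemma face_of_hull_eq_hull_indices:
  fixes s :: "'i \<Rightarrow> 'a::euclidean_space"
  assumes "finite N" "F face_of convex hull (s ` N)"
  shows "F = convex hull (s ` {i\<in>N. s i \<in> F})"
proof -
  obtain S' where S': "S' \<subseteq> s ` N" "F = convex hull S'"
    by (rule face_of_convex_hull_subset[OF finite_imp_compact[OF finite_imageI[OF assms(1)]] assms(2)])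
  have "S' \<subseteq> F" unfolding S'(2) by (rule hull_subset)
  then have "S' \<subseteq> s ` {i\<in>N. s i \<in> F}" using S'(1) by blast
  then have "F \<subseteq> convex hull (s ` {i\<in>N. s i \<in> F})" by (subst S'(2)) (rule hull_mono)
  moreover have "convex hull (s ` {i\<in>N. s i \<in> F}) \<subseteq> F"
    using face_of_imp_convex[OF assms(2)] by (intro hull_minimal) auto
  ultimately show ?thesis by blast
qed

text \<open>
  Faces of polytopes are exposed, and an exposing functional is the required direction.
\<close>

lemma face_indices_strict_maximizer:
  fixes s :: "'i \<Rightarrow> 'a::euclidean_space"
  assumes "finite N" "F face_of convex hull (s ` N)"
  defines "J \<equiv> {i\<in>N. s i \<in> F}"
  obtains a where "a \<in> level_space s J" "a \<in> strict_maximizers s N J"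
proof -
  have "polyhedron (convex hull (s ` N))"
    using assms(1) by (intro polytope_imp_polyhedron polytope_convex_hull) auto
  then have "F exposed_face_of convex hull (s ` N)"
    using exposed_face_of_polyhedron assms(2) by blast
  then obtain a b where ab: "convex hull (s ` N) \<subseteq> {x. a \<bullet> x \<le> b}"
      "F = convex hull (s ` N) \<inter> {x. a \<bullet> x = b}"
    by (auto simp: exposed_face_of_def)
  have P: "s i \<in> convex hull (s ` N)" if "i \<in> N" for i using that by (simp add: hull_inc)
  have J: "a \<bullet> s i = b" if "i \<in> J" for i using that ab by (auto simp: J_def)
  have NJ: "a \<bullet> s i < b" if "i \<in> N - J" for i
  proof -
    have "a \<bullet> s i \<le> b" "a \<bullet> s i \<noteq> b" using that ab P[of i] by (auto simp: J_def)
    then show ?thesis by simp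
  qed
  show ?thesis
    using J NJ by (intro that[of a]) (auto simp: level_space_def strict_maximizers_def)
qed

lemma strict_maximizer_face:
  fixes s :: "'i \<Rightarrow> 'a::euclidean_space"
  assumes "finite N" "J \<subseteq> N" "J \<noteq> {}" "a \<in> level_space s J" "a \<in> strict_maximizers s N J"
  shows "convex hull (s ` J) face_of convex hull (s ` N)"
    and "{i\<in>N. s i \<in> convex hull (s ` J)} = J"
proof -
  obtain k where k: "k \<in> J" using assms by blast
  define b where "b = a \<bullet> s k"
  define F where "F = convex hull (s ` N) \<inter> {x. a \<bullet> x = b}"
  have J: "a \<bullet> s i = b" if "i \<in> J" for i
    using assms(4) k that unfolding level_space_def b_def by blast
  have NJ: "a \<bullet> s i < b" if "i \<in> N" "i \<notin> J" for i
    using assms(5) k that by (auto simp: strict_maximizers_def b_def)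
  have le: "a \<bullet> s i \<le> b" if "i \<in> N" for i using J[of i] NJ[of i] that by fastforce
  have F: "F face_of convex hull (s ` N)"
    unfolding F_def
    by (rule face_of_Int_supporting_hyperplane_le)
       (auto intro: convex_hull_image_inner_le le)
  have ind: "{i\<in>N. s i \<in> F} = J"
    using J NJ assms(2) by (force simp: F_def hull_inc)
  have "F = convex hull (s ` J)" using face_of_hull_eq_hull_indices[OF assms(1) F] ind by simp
  with F ind show "convex hull (s ` J) face_of convex hull (s ` N)"
    "{i\<in>N. s i \<in> convex hull (s ` J)} = J" by auto
qed

lemma normal_cone_eq_weak_maximizers:
  fixes s :: "'i \<Rightarrow> 'a::euclidean_space"
  assumes N: "finite N" and F: "F face_of convex hull (s ` N)" "F \<noteq> {}"
  shows "normal_cone (convex hull (s ` N)) F = weak_maximizers s N {i\<in>N. s i \<in> F}"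
proof -
  define P where "P = convex hull (s ` N)"
  define J where "J = {i\<in>N. s i \<in> F}"
  have FJ: "F = convex hull (s ` J)" using face_of_hull_eq_hull_indices[OF N F(1)] by (simp add: J_def)
  have FP: "F face_of P" "convex P" "F \<subseteq> P" using F face_of_imp_subset by (auto simp: P_def)
  obtain f where f: "f \<in> rel_interior F"
    using F rel_interior_eq_empty face_of_imp_convex by blast
  have fF: "f \<in> F" "f \<in> P" using f rel_interior_subset FP by auto
  have sP: "s i \<in> P" if "i \<in> N" for i using that by (simp add: hull_inc P_def)
  have T: "tangent_cone P F = {v. \<exists>\<epsilon>>0. f + \<epsilon> *\<^sub>R v \<in> P}"
    by (rule tangent_cone_eq[OF FP(2,1) f])
  have nc: "w \<in> normal_cone P F \<longleftrightarrow> (\<forall>x\<in>P. w \<bullet> x \<le> w \<bullet> f)" for w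
  proof
    assume w: "w \<in> normal_cone P F"
    show "\<forall>x\<in>P. w \<bullet> x \<le> w \<bullet> f"
    proof
      fix x assume "x \<in> P"
      then have "x - f \<in> tangent_cone P F" unfolding T by (auto intro!: exI[of _ 1])
      then show "w \<bullet> x \<le> w \<bullet> f"
        using w by (auto simp: normal_cone_def polar_cone_def inner_diff_right)
    qed
  next
    assume w: "\<forall>x\<in>P. w \<bullet> x \<le> w \<bullet> f"
    have "w \<bullet> v \<le> 0" if "\<epsilon> > 0" "f + \<epsilon> *\<^sub>R v \<in> P" for v \<epsilon>
    proof -
      have "\<epsilon> * (w \<bullet> v) \<le> 0" using w that(2) by (auto simp: inner_add_right)
      then show ?thesis using that(1) by (simp add: mult_le_0_iff)
    qed
    then show "w \<in> normal_cone P F" by (auto simp: normal_cone_def polar_cone_def T)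
  qed
  have "w \<in> normal_cone P F \<longleftrightarrow> w \<in> weak_maximizers s N J" for w
  proof
    assume w: "w \<in> normal_cone P F"
    then have le: "w \<bullet> x \<le> w \<bullet> f" if "x \<in> P" for x using nc that by blast
    have "P \<inter> {x. w \<bullet> x = w \<bullet> f} face_of P"
      by (rule face_of_Int_supporting_hyperplane_le) (use FP le in auto)
    \<comment> \<open>a supporting hyperplane through a relative interior point of a face contains the face\<close>
    then have "F \<subseteq> P \<inter> {x. w \<bullet> x = w \<bullet> f}"
      by (rule subset_of_face_of) (use FP f fF in auto)
    then show "w \<in> weak_maximizers s N J"
      using le sP by (auto simp: weak_maximizers_def J_def)
  next
    assume w: "w \<in> weak_maximizers s N J"
    have le: "w \<bullet> x \<le> w \<bullet> s k" if "x \<in> P" "k \<in> J" for x k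
      using convex_hull_image_inner_le[OF that(1)[unfolded P_def], of w "w \<bullet> s k"] w that(2)
      unfolding weak_maximizers_def by blast
    have "(- w) \<bullet> f \<le> - (w \<bullet> x)" if "x \<in> P" for x
    proof (rule convex_hull_image_inner_le[where s = s and N = J])
      show "f \<in> convex hull (s ` J)" using fF(1) by (simp flip: FJ)
      fix k assume "k \<in> J"
      from le[OF that this] show "(- w) \<bullet> s k \<le> - (w \<bullet> x)" by simp
    qed
    then show "w \<in> normal_cone P F" using nc by simp
  qed
  then show ?thesis by (auto simp: P_def J_def)
qed

lemma weak_maximizersI:
  assumes "w \<in> strict_maximizers s N J" "w \<in> level_space s J"
  shows "w \<in> weak_maximizers s N J"
  unfolding weak_maximizers_def
proof (intro CollectI ballI)
  fix i k assume "i \<in> N" "k \<in> J"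
  then show "w \<bullet> s i \<le> w \<bullet> s k"
    using assms unfolding level_space_def strict_maximizers_def
    by (cases "i \<in> J") (blast intro: eq_refl less_imp_le)+
qed

text \<open>
  Strict inequalities survive small perturbations: if \<open>a\<close> is a strict maximizer in the level space,
  then so is \<open>a + e v\<close> for every \<open>v\<close> in the level space and small \<open>e > 0\<close>, and \<open>v\<close> is a multiple of the
  difference of the two.
\<close>

lemma span_weak_maximizers:
  fixes s :: "'i \<Rightarrow> 'a::euclidean_space"
  assumes N: "finite N" "J \<subseteq> N" and a: "a \<in> level_space s J" "a \<in> strict_maximizers s N J"
  shows "span (weak_maximizers s N J) = level_space s J"
proof (rule span_subspace[OF _ _ subspace_level_space])
  show "weak_maximizers s N J \<subseteq> level_space s J"
    using N by (auto simp: weak_maximizers_def level_space_def intro!: antisym)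
  show "level_space s J \<subseteq> span (weak_maximizers s N J)"
  proof
    fix v assume v: "v \<in> level_space s J"
    have "\<forall>i\<in>N - J. eventually (\<lambda>e. \<forall>k\<in>J. (a + e *\<^sub>R v) \<bullet> s i < (a + e *\<^sub>R v) \<bullet> s k) (at_right 0)"
    proof (intro ballI eventually_ball_finite)
      show "finite J" using N finite_subset by blast
      fix i k assume ik: "i \<in> N - J" "k \<in> J"
      have lim: "((\<lambda>e. (a + e *\<^sub>R v) \<bullet> s m) \<longlongrightarrow> (a + 0 *\<^sub>R v) \<bullet> s m) (at_right 0)" for m
        by (intro tendsto_intros)
      have "(a + 0 *\<^sub>R v) \<bullet> s i < (a + 0 *\<^sub>R v) \<bullet> s k" using a ik by (simp add: strict_maximizers_def)
      then have "eventually (\<lambda>e. 0 < (a + e *\<^sub>R v) \<bullet> s k - (a + e *\<^sub>R v) \<bullet> s i) (at_right 0)"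
        using order_tendstoD(1)[OF tendsto_diff[OF lim lim], of 0 k i] by simp
      then show "eventually (\<lambda>e. (a + e *\<^sub>R v) \<bullet> s i < (a + e *\<^sub>R v) \<bullet> s k) (at_right 0)"
        by (rule eventually_mono) simp
    qed
    then have "eventually (\<lambda>e. a + e *\<^sub>R v \<in> strict_maximizers s N J \<and> e > 0) (at_right 0)"
      using N unfolding strict_maximizers_def
      by (auto intro!: eventually_conj eventually_ball_finite simp: eventually_at_right_less)
    then obtain e where e: "a + e *\<^sub>R v \<in> strict_maximizers s N J" "e > 0"
      using eventually_happens' trivial_limit_at_right_real by blast
    have "a + e *\<^sub>R v \<in> weak_maximizers s N J"
      using e a v subspace_level_space[of s J] by (intro weak_maximizersI) (auto intro: subspace_add subspace_scale)
    then have "(1 / e) *\<^sub>R ((a + e *\<^sub>R v) - a) \<in> span (weak_maximizers s N J)"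
      using weak_maximizersI[OF a(2,1)] by (intro span_scale span_diff) (auto intro: span_base)
    then show "v \<in> span (weak_maximizers s N J)" using e by simp
  qed
qed

lemma closed_weak_maximizers: "closed (weak_maximizers s N J)"
proof -
  have "weak_maximizers s N J = (\<Inter>i\<in>N. \<Inter>k\<in>J. {w. w \<bullet> s i \<le> w \<bullet> s k})"
    by (auto simp: weak_maximizers_def)
  then show ?thesis by (auto intro!: closed_INT closed_Collect_le continuous_intros)
qed

lemma strict_maximizers_borel: "finite N \<Longrightarrow> finite J \<Longrightarrow> strict_maximizers s N J \<in> sets borel"
  unfolding strict_maximizers_def by measurable

lemma sets_closest_point_strict_maximizers:
  assumes "finite N" "finite J"
  shows "{u. closest_point (level_space s J) u \<in> strict_maximizers s N J} \<in> sets ball_measure"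
  using measurable_sets[OF borel_measurable_continuous_onI[OF
      continuous_on_closest_point_subspace[OF subspace_level_space]] strict_maximizers_borel[OF assms, of s]]
  by (simp add: vimage_def)

text \<open>
  This turns out to be the angle of the normal cone at \<open>F\<close> if \<open>J\<close> consists of all indices of points
  on the face \<open>F\<close>. For nonempty \<open>J\<close> that do not arise from a face in this way it is \<open>0\<close>.
\<close>

definition direction_prob :: "('i \<Rightarrow> 'a::euclidean_space) \<Rightarrow> 'i set \<Rightarrow> 'i set \<Rightarrow> real" where
  "direction_prob s N J =
     measure ball_measure {u. closest_point (level_space s J) u \<in> strict_maximizers s N J}"

text \<open>
  The normal cone consists of the weak maximizers and spans the level space. Replacing weak by strict
  inequalities changes the event only on finitely many hyperplanes of directions \<open>u\<close>.
\<close>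

lemma solid_angle_normal_cone:
  fixes s :: "'i \<Rightarrow> 'a::euclidean_space"
  assumes N: "finite N" and F: "F face_of convex hull (s ` N)" "F \<noteq> {}"
    and dim: "aff_dim F < int DIM('a)"
  shows "solid_angle (normal_cone (convex hull (s ` N)) F) = direction_prob s N {i\<in>N. s i \<in> F}"
proof -
  define J where "J = {i\<in>N. s i \<in> F}"
  have J: "J \<subseteq> N" "finite J" using N by (auto simp: J_def)
  have FJ: "F = convex hull (s ` J)" using face_of_hull_eq_hull_indices[OF N F(1)] by (simp add: J_def)
  obtain a where a: "a \<in> level_space s J" "a \<in> strict_maximizers s N J"
    using face_indices_strict_maximizer[OF N F(1)] unfolding J_def .
  note W = subspace_level_space[of s J]
  define p where "p = closest_point (level_space s J)"
  note pW = closest_point_subspace_in[OF W, folded p_def]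
  have pm [measurable]: "p \<in> borel_measurable borel"
    unfolding p_def by (intro borel_measurable_continuous_onI continuous_on_closest_point_subspace W)
  have "solid_angle (normal_cone (convex hull (s ` N)) F) = solid_angle (weak_maximizers s N J)"
    using normal_cone_eq_weak_maximizers[OF N F] by (simp add: J_def)
  also have "\<dots> = measure ball_measure {u. p u \<in> weak_maximizers s N J}"
    unfolding p_def
  proof (rule solid_angle_eq_ball_measure[OF W])
    show "level_space s J \<noteq> {0}"
      using dim unfolding FJ aff_dim_convex_hull by (rule level_space_nontrivial)
    show "span (weak_maximizers s N J) = level_space s J" by (rule span_weak_maximizers[OF N J(1) a])
    show "weak_maximizers s N J \<in> sets borel" by (intro borel_closed closed_weak_maximizers)
  qed (auto simp: weak_maximizers_def)
  also have "\<dots> = measure ball_measure {u. p u \<in> strict_maximizers s N J}"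
  proof (rule measure_eq_AE)
    show "{u. p u \<in> weak_maximizers s N J} \<in> sets ball_measure"
      using measurable_sets[OF pm borel_closed[OF closed_weak_maximizers[of s N J]]] by (simp add: vimage_def)
    show "{u. p u \<in> strict_maximizers s N J} \<in> sets ball_measure"
      unfolding p_def by (rule sets_closest_point_strict_maximizers[OF N J(2)])
    have "AE u in ball_measure. \<forall>i\<in>N - J. \<forall>k\<in>J. p u \<bullet> s i \<noteq> p u \<bullet> s k"
    proof (intro AE_finite_allI)
      fix i k assume ik: "i \<in> N - J" "k \<in> J"
      \<comment> \<open>the exposing functional shows that s i - s k has a nonzero component in the level space\<close>
      have "a \<bullet> s i < a \<bullet> s k" using a ik by (auto simp: strict_maximizers_def)
      then have "p (s i - s k) \<noteq> 0"
        using closest_point_subspace_orth[OF W a(1), of "s i - s k"]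
        by (auto simp: p_def inner_diff_right inner_commute)
      from AE_ball_measure_inner_nonzero[OF this]
      show "AE u in ball_measure. p u \<bullet> s i \<noteq> p u \<bullet> s k"
      proof eventually_elim
        case (elim u)
        then show ?case
          using closest_point_subspace_selfadjoint[OF W, of u "s i - s k"]
          by (auto simp: p_def inner_diff_right)
      qed
    qed (use N J in auto)
    then show "AE u in ball_measure. (u \<in> {u. p u \<in> weak_maximizers s N J}) =
        (u \<in> {u. p u \<in> strict_maximizers s N J})"
    proof eventually_elim
      case (elim u)
      have "p u \<in> weak_maximizers s N J" if "p u \<in> strict_maximizers s N J"
        using that pW[of u] by (rule weak_maximizersI)
      moreover have "p u \<bullet> s i < p u \<bullet> s k"
        if "p u \<in> weak_maximizers s N J" "i \<in> N - J" "k \<in> J" for i k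
        using that elim by (auto simp: weak_maximizers_def less_le)
      ultimately show ?case by (auto simp: strict_maximizers_def)
    qed
  qed
  finally show ?thesis by (simp add: J_def p_def direction_prob_def)
qed

text \<open>
  Faces correspond to their index sets. An index set that does not come from a face has no strict
  maximizer in its level space, because such a direction would expose a face; so it may be included in
  the sum at no cost.
\<close>

lemma sum_solid_angle_eq_sum_direction_prob:
  fixes s :: "'i \<Rightarrow> 'a::euclidean_space"
  assumes N: "finite N" and j: "j < DIM('a)"
  shows "(\<Sum>F\<in>faces_of_dim j (convex hull (s ` N)). solid_angle (normal_cone (convex hull (s ` N)) F)) =
    (\<Sum>J | J \<subseteq> N \<and> aff_dim (s ` J) = int j. direction_prob s N J)"
proof -
  define ind where "ind F = {i\<in>N. s i \<in> F}" for F
  let ?Fs = "faces_of_dim j (convex hull (s ` N))"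
  have F: "F face_of convex hull (s ` N)" "F \<noteq> {}" "aff_dim F = int j" "convex hull (s ` ind F) = F"
    if "F \<in> ?Fs" for F
    using that face_of_hull_eq_hull_indices[OF N, of F s] by (auto simp: faces_of_dim_def ind_def)
  have inj: "inj_on ind ?Fs" using F(4) by (metis inj_onI)
  have "(\<Sum>F\<in>?Fs. solid_angle (normal_cone (convex hull (s ` N)) F)) = (\<Sum>F\<in>?Fs. direction_prob s N (ind F))"
    using F j unfolding ind_def by (intro sum.cong solid_angle_normal_cone N) auto
  also have "\<dots> = (\<Sum>J\<in>ind ` ?Fs. direction_prob s N J)"
    using inj by (simp add: sum.reindex)
  also have "\<dots> = (\<Sum>J | J \<subseteq> N \<and> aff_dim (s ` J) = int j. direction_prob s N J)"
  proof (rule sum.mono_neutral_left)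
    show "finite {J. J \<subseteq> N \<and> aff_dim (s ` J) = int j}" using N by simp
    show "ind ` ?Fs \<subseteq> {J. J \<subseteq> N \<and> aff_dim (s ` J) = int j}"
    proof
      fix J assume "J \<in> ind ` ?Fs"
      then obtain F' where F': "F' \<in> ?Fs" "J = ind F'" by blast
      then show "J \<in> {J. J \<subseteq> N \<and> aff_dim (s ` J) = int j}"
        using F(3,4)[OF F'(1)] aff_dim_convex_hull[of "s ` J"] by (auto simp: ind_def)
    qed
    show "\<forall>J\<in>{J. J \<subseteq> N \<and> aff_dim (s ` J) = int j} - ind ` ?Fs. direction_prob s N J = 0"
    proof
      fix J assume J: "J \<in> {J. J \<subseteq> N \<and> aff_dim (s ` J) = int j} - ind ` ?Fs"
      then have J': "J \<subseteq> N" "J \<noteq> {}" "aff_dim (s ` J) = int j" by auto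
      have "{u. closest_point (level_space s J) u \<in> strict_maximizers s N J} = {}"
      proof (rule equals0I)
        fix u assume "u \<in> {u. closest_point (level_space s J) u \<in> strict_maximizers s N J}"
        then have "convex hull (s ` J) face_of convex hull (s ` N)" "ind (convex hull (s ` J)) = J"
          unfolding ind_def
          by (intro strict_maximizer_face[OF N J'(1,2) closest_point_subspace_in[OF subspace_level_space]];
              simp)+
        then have "J \<in> ind ` ?Fs"
          using J'(3) by (intro image_eqI[of _ _ "convex hull (s ` J)"]) (auto simp: faces_of_dim_def aff_dim_convex_hull)
        with J show False by blast
      qed
      then show "direction_prob s N J = 0" by (simp add: direction_prob_def)
    qed
  qed
  finally show ?thesis .
qed

section \<open>Measurability of the angle sum\<close>

text \<open>
  Gram-Schmidt orthogonalisation of \<open>u\<close> against a list of vectors. A vector that depends linearly on the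
  later ones has residual \<open>0\<close> and, as division by zero gives zero, is skipped. The explicit
  recursion makes projections measurable in \<open>u\<close> and in the vectors jointly.
\<close>

fun residual :: "'a::euclidean_space list \<Rightarrow> 'a \<Rightarrow> 'a" where
  "residual [] u = u"
| "residual (x # xs) u =
     residual xs u - ((residual xs u \<bullet> residual xs x) / (residual xs x \<bullet> residual xs x)) *\<^sub>R residual xs x"

lemma residual_diff_span: "u - residual xs u \<in> span (set xs)"
proof (induction xs arbitrary: u)
  case (Cons x xs)
  have 1: "v - residual xs v \<in> span (set (x # xs))" for v
    using Cons.IH[of v] span_mono[of "set xs" "set (x # xs)"] by auto
  have 2: "residual xs x \<in> span (set (x # xs))"
    using span_diff[OF span_base[of x "set (x # xs)"] 1[of x]] by simp
  have "(u - residual xs u) +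
      ((residual xs u \<bullet> residual xs x) / (residual xs x \<bullet> residual xs x)) *\<^sub>R residual xs x
      \<in> span (set (x # xs))"
    using 1[of u] 2 by (intro span_add span_scale)
  then show ?case by (simp add: algebra_simps)
qed simp

lemma inner_zero_on_span:
  assumes "\<forall>y\<in>S. w \<bullet> y = 0" "z \<in> span S"
  shows "w \<bullet> z = 0"
  using orthogonal_to_span[OF assms(2), of w] assms(1) by (auto simp: orthogonal_def)

lemma residual_orthogonal: "z \<in> set xs \<Longrightarrow> residual xs u \<bullet> z = 0"
proof (induction xs arbitrary: u z)
  case (Cons x xs)
  define r where "r = residual xs u"
  define y where "y = residual xs x"
  have "\<forall>z\<in>set xs. r \<bullet> z = 0" "\<forall>z\<in>set xs. y \<bullet> z = 0"
    using Cons.IH by (auto simp: r_def y_def)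
  then have "r \<bullet> (x - y) = 0" "y \<bullet> (x - y) = 0"
    using inner_zero_on_span residual_diff_span[of x xs] by (auto simp: y_def)
  then have "r \<bullet> x = r \<bullet> y" "y \<bullet> x = y \<bullet> y" by (auto simp: inner_diff_right)
  then have "(r - ((r \<bullet> y) / (y \<bullet> y)) *\<^sub>R y) \<bullet> x = 0"
    by (cases "y = 0") (auto simp: inner_diff_left)
  then show ?case
    using Cons by (auto simp: r_def y_def inner_diff_left)
qed simp

lemma closest_point_eq_residual:
  "closest_point {w. \<forall>y\<in>set xs. w \<bullet> y = 0} u = residual xs u"
proof -
  have "subspace {w. \<forall>y\<in>set xs. w \<bullet> y = 0}"
    by (auto simp: subspace_def inner_add_left)
  moreover have "(u - residual xs u) \<bullet> w = 0" if "\<forall>y\<in>set xs. w \<bullet> y = 0" for w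
    using inner_zero_on_span[OF that residual_diff_span] by (simp add: inner_commute)
  ultimately show ?thesis
    by (simp add: closest_point_subspace_iff residual_orthogonal)
qed

lemma residual_eq_0_iff: "residual xs x = 0 \<longleftrightarrow> x \<in> span (set xs)"
proof
  assume "residual xs x = 0"
  then show "x \<in> span (set xs)" using residual_diff_span[of x xs] by simp
next
  assume "x \<in> span (set xs)"
  then have "x - (x - residual xs x) \<in> span (set xs)"
    by (rule span_diff[OF _ residual_diff_span])
  then have "residual xs x \<bullet> residual xs x = 0"
    by (intro inner_zero_on_span[of "set xs"]) (auto simp: residual_orthogonal)
  then show "residual xs x = 0" by simp
qed

lemma borel_measurable_residual:
  fixes fs :: "('w \<Rightarrow> 'a::euclidean_space) list"
  assumes "\<And>f. f \<in> set fs \<Longrightarrow> f \<in> borel_measurable M" "g \<in> borel_measurable M"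
  shows "(\<lambda>\<omega>. residual (map (\<lambda>f. f \<omega>) fs) (g \<omega>)) \<in> borel_measurable M"
  using assms
proof (induction fs arbitrary: g)
  case (Cons f fs)
  have [measurable]: "(\<lambda>\<omega>. residual (map (\<lambda>f. f \<omega>) fs) (g \<omega>)) \<in> borel_measurable M"
    "(\<lambda>\<omega>. residual (map (\<lambda>f. f \<omega>) fs) (f \<omega>)) \<in> borel_measurable M"
    using Cons by auto
  show ?case by simp
qed simp

text \<open>
  The dimension of the span grows by one exactly when the residual of the new vector is nonzero.
\<close>

lemma measurable_dim:
  fixes fs :: "('w \<Rightarrow> 'a::euclidean_space) list"
  assumes "\<And>f. f \<in> set fs \<Longrightarrow> f \<in> borel_measurable M"
  shows "(\<lambda>\<omega>. dim (set (map (\<lambda>f. f \<omega>) fs))) \<in> measurable M (count_space UNIV)"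
  using assms
proof (induction fs)
  case (Cons f fs)
  have [measurable]: "(\<lambda>\<omega>. dim (set (map (\<lambda>f. f \<omega>) fs))) \<in> measurable M (count_space UNIV)"
    "(\<lambda>\<omega>. residual (map (\<lambda>f. f \<omega>) fs) (f \<omega>)) \<in> borel_measurable M"
    using Cons by (auto intro: borel_measurable_residual)
  have "(\<lambda>\<omega>. dim (set (map (\<lambda>f. f \<omega>) (f # fs)))) =
      (\<lambda>\<omega>. if residual (map (\<lambda>f. f \<omega>) fs) (f \<omega>) = 0 then dim (set (map (\<lambda>f. f \<omega>) fs))
        else dim (set (map (\<lambda>f. f \<omega>) fs)) + 1)"
    by (rule ext) (simp add: dim_insert residual_eq_0_iff)
  then show ?case by simp
qed simp

lemma measurable_aff_dim:
  fixes s :: "'w \<Rightarrow> 'i \<Rightarrow> 'a::euclidean_space"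
  assumes "finite J" and s: "\<And>i. i \<in> J \<Longrightarrow> (\<lambda>\<omega>. s \<omega> i) \<in> borel_measurable M"
  shows "(\<lambda>\<omega>. aff_dim (s \<omega> ` J)) \<in> measurable M (count_space UNIV)"
proof (cases "J = {}")
  case False
  then obtain k where k: "k \<in> J" by blast
  obtain js where js: "set js = J" using assms finite_list by blast
  have "aff_dim (s \<omega> ` J) = int (dim (set (map (\<lambda>f. f \<omega>) (map (\<lambda>i \<omega>. s \<omega> i - s \<omega> k) js))))" for \<omega>
    using aff_dim_eq_dim_subtract[of "s \<omega> k" "s \<omega> ` J"] k js
    by (simp add: image_image hull_inc)
  moreover have "(\<lambda>\<omega>. dim (set (map (\<lambda>f. f \<omega>) (map (\<lambda>i \<omega>. s \<omega> i - s \<omega> k) js))))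
      \<in> measurable M (count_space UNIV)"
    using s k js by (intro measurable_dim) auto
  ultimately show ?thesis by (auto intro: measurable_compose)
qed simp

lemma closest_point_level_space_eq_residual:
  assumes "k \<in> J" "set js = J"
  shows "closest_point (level_space s J) u = residual (map (\<lambda>i. s i - s k) js) u"
proof -
  have "level_space s J = {w. \<forall>y\<in>set (map (\<lambda>i. s i - s k) js). w \<bullet> y = 0}"
  proof (intro set_eqI iffI)
    fix w assume "w \<in> level_space s J"
    then have "w \<bullet> (s i - s k) = 0" if "i \<in> J" for i
      by (rule level_spaceD[OF _ that assms(1)])
    then show "w \<in> {w. \<forall>y\<in>set (map (\<lambda>i. s i - s k) js). w \<bullet> y = 0}"
      using assms by auto
  next
    fix w assume "w \<in> {w. \<forall>y\<in>set (map (\<lambda>i. s i - s k) js). w \<bullet> y = 0}"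
    then have "w \<bullet> (s i - s k) = 0" if "i \<in> J" for i
      using assms that by simp
    then show "w \<in> level_space s J"
      by (intro level_spaceI[where c = "w \<bullet> s k"]) (simp add: inner_diff_right)
  qed
  then show ?thesis by (simp only: closest_point_eq_residual)
qed

lemma borel_measurable_direction_prob:
  fixes s :: "'w \<Rightarrow> 'i \<Rightarrow> 'a::euclidean_space"
  assumes N: "finite N" "J \<subseteq> N" "J \<noteq> {}"
    and s: "\<And>i. i \<in> N \<Longrightarrow> (\<lambda>\<omega>. s \<omega> i) \<in> borel_measurable M"
  shows "(\<lambda>\<omega>. direction_prob (s \<omega>) N J) \<in> borel_measurable M"
proof -
  obtain k where k: "k \<in> J" using N by blast
  have J: "finite J" using N finite_subset by blast
  obtain js where js: "set js = J" using J finite_list by blast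
  define S where "S = (\<lambda>i (z :: 'w \<times> 'a). s (fst z) i)"
  let ?B = "M \<Otimes>\<^sub>M (ball_measure :: 'a measure)"
  have Sm [measurable]: "S i \<in> borel_measurable ?B" if "i \<in> N" for i
    unfolding S_def using s[OF that] by measurable
  define p where "p z = residual (map (\<lambda>f. f z) (map (\<lambda>i z. S i z - S k z) js)) (snd z)" for z
  have pm [measurable]: "p \<in> borel_measurable ?B"
    unfolding p_def
  proof (rule borel_measurable_residual)
    fix f assume "f \<in> set (map (\<lambda>i z. S i z - S k z) js)"
    then show "f \<in> borel_measurable ?B" using js k N(2) by (auto intro!: borel_measurable_diff Sm)
  qed (measurable)
  define Q where "Q = {z \<in> space ?B. \<forall>i\<in>N - J. \<forall>k\<in>J. p z \<bullet> S i z < p z \<bullet> S k z}"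
  have "{z \<in> space ?B. p z \<bullet> S i z < p z \<bullet> S k z} \<in> sets ?B" if "i \<in> N" "k \<in> N" for i k
  proof -
    note [measurable] = Sm[OF that(1)] Sm[OF that(2)]
    show ?thesis by measurable
  qed
  then have "Q \<in> sets ?B"
    unfolding Q_def using N J by (intro sets.sets_Collect_finite_All) auto
  then have "(\<lambda>\<omega>. emeasure ball_measure (Pair \<omega> -` Q)) \<in> borel_measurable M"
    by (rule ball_measure.measurable_emeasure_Pair)
  then have "(\<lambda>\<omega>. measure ball_measure (Pair \<omega> -` Q)) \<in> borel_measurable M"
    unfolding measure_def by measurable
  moreover have "Pair \<omega> -` Q = {u. closest_point (level_space (s \<omega>) J) u \<in> strict_maximizers (s \<omega>) N J}"
    if "\<omega> \<in> space M" for \<omega>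
    using that closest_point_level_space_eq_residual[OF k js, of "s \<omega>"]
    by (auto simp: Q_def p_def S_def space_pair_measure strict_maximizers_def comp_def)
  ultimately show ?thesis
    by (subst measurable_cong[where g = "\<lambda>\<omega>. measure ball_measure (Pair \<omega> -` Q)"])
       (auto simp: direction_prob_def)
qed

lemma borel_measurable_sum_direction_prob:
  fixes s :: "'w \<Rightarrow> 'i \<Rightarrow> 'a::euclidean_space"
  assumes N: "finite N" and s: "\<And>i. i \<in> N \<Longrightarrow> (\<lambda>\<omega>. s \<omega> i) \<in> borel_measurable M"
  shows "(\<lambda>\<omega>. \<Sum>J | J \<subseteq> N \<and> aff_dim (s \<omega> ` J) = int j. direction_prob (s \<omega>) N J) \<in> borel_measurable M"
proof -
  have "(\<Sum>J | J \<subseteq> N \<and> aff_dim (s \<omega> ` J) = int j. direction_prob (s \<omega>) N J) =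
      (\<Sum>J\<in>Pow N - {{}}. if aff_dim (s \<omega> ` J) = int j then direction_prob (s \<omega>) N J else 0)" for \<omega>
    using N by (intro sum.mono_neutral_cong_left) auto
  moreover have "(\<lambda>\<omega>. \<Sum>J\<in>Pow N - {{}}. if aff_dim (s \<omega> ` J) = int j then direction_prob (s \<omega>) N J else 0)
      \<in> borel_measurable M"
  proof (rule borel_measurable_sum)
    fix J assume J: "J \<in> Pow N - {{}}"
    have [measurable]: "(\<lambda>\<omega>. direction_prob (s \<omega>) N J) \<in> borel_measurable M"
      using J by (intro borel_measurable_direction_prob N s) auto
    have [measurable]: "(\<lambda>\<omega>. aff_dim (s \<omega> ` J)) \<in> measurable M (count_space UNIV)"
      using J N finite_subset by (intro measurable_aff_dim s) auto
    show "(\<lambda>\<omega>. if aff_dim (s \<omega> ` J) = int j then direction_prob (s \<omega>) N J else 0) \<in> borel_measurable M"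
      by measurable
  qed
  ultimately show ?thesis by simp
qed

section \<open>Negative bridges and cutting at the maximum\<close>

lemma unique_strict_maximum:
  fixes f :: "'b \<Rightarrow> real"
  assumes "finite S" "S \<noteq> {}" "inj_on f S"
  shows "\<exists>!k. k \<in> S \<and> (\<forall>i\<in>S. i \<noteq> k \<longrightarrow> f i < f k)"
proof -
  have fS: "finite (f ` S)" "f ` S \<noteq> {}" using assms(1,2) by auto
  obtain k where k: "k \<in> S" "f k = Max (f ` S)" using Max_in[OF fS] by auto
  have lt: "f i < f k" if "i \<in> S" "i \<noteq> k" for i
  proof -
    have "f i \<le> f k" using k(2) Max_ge[OF fS(1), of "f i"] that(1) by simp
    moreover have "f i \<noteq> f k" using inj_onD[OF assms(3) _ that(1) k(1)] that(2) by blast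
    ultimately show ?thesis by simp
  qed
  show ?thesis
  proof (intro ex1I conjI ballI impI)
    fix i assume i: "i \<in> S \<and> (\<forall>j\<in>S. j \<noteq> i \<longrightarrow> f j < f i)"
    show "i = k"
    proof (rule ccontr)
      assume "i \<noteq> k"
      then have "f k < f i" "f i < f k" using i k lt[of i] by auto
      then show False by simp
    qed
  qed (use k lt in auto)
qed

text \<open>
  In the three following predicates \<open>y\<close> gives the increments of a real walk and \<open>Q\<close> is imposed on
  its level relative to the level at the cut positions. The count uses \<open>Q t \<longleftrightarrow> t < 0\<close>, while
  \<open>Q t \<longleftrightarrow> t \<noteq> 0\<close> expresses genericity. Inside a block the end points are exempt.
\<close>

definition block_ok :: "('i \<Rightarrow> real) \<Rightarrow> (real \<Rightarrow> bool) \<Rightarrow> 'i list \<Rightarrow> bool" where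
  "block_ok y Q B \<longleftrightarrow> (\<forall>i. 0 < i \<and> i < length B \<longrightarrow> Q (sum_list (map y (take i B))))"

definition tail_ok :: "('i \<Rightarrow> real) \<Rightarrow> (real \<Rightarrow> bool) \<Rightarrow> 'i list \<Rightarrow> bool" where
  "tail_ok y Q zs \<longleftrightarrow> (\<forall>i. 0 < i \<and> i \<le> length zs \<longrightarrow> Q (sum_list (map y (take i zs))))"

text \<open>
  A head ends at the first cut position, so the relative levels along it are the negatives of
  the sums of its final segments.
\<close>

definition head_ok :: "('i \<Rightarrow> real) \<Rightarrow> (real \<Rightarrow> bool) \<Rightarrow> 'i list \<Rightarrow> bool" where
  "head_ok y Q zs \<longleftrightarrow> (\<forall>i<length zs. Q (- sum_list (map y (drop i zs))))"

lemma sum_list_map_drop: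
  fixes y :: "'i \<Rightarrow> real"
  shows "sum_list (map y (drop k zs)) = sum_list (map y zs) - sum_list (map y (take k zs))"
  by (metis add_diff_cancel_left' append_take_drop_id map_append sum_list_append)

lemma sum_list_take_drop:
  fixes y :: "'i \<Rightarrow> real"
  shows "sum_list (map y (take i (drop k zs))) =
    sum_list (map y (take (k + i) zs)) - sum_list (map y (take k zs))"
  by (simp add: take_add)

lemma sum_list_take_rotate:
  fixes y :: "'i \<Rightarrow> real"
  assumes "sum_list (map y zs) = 0" "k < length zs" "i < length zs"
  shows "sum_list (map y (take i (rotate k zs))) =
    sum_list (map y (take ((k + i) mod length zs) zs)) - sum_list (map y (take k zs))"
proof (cases "k + i < length zs")
  case True
  then show ?thesis using assms by (simp add: rotate_drop_take sum_list_take_drop)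
next
  case False
  then have "(k + i) mod length zs = i - (length zs - k)"
    using assms by (simp add: le_mod_geq)
  moreover have "take i (rotate k zs) = drop k zs @ take (i - (length zs - k)) zs"
    using assms False by (simp add: rotate_drop_take min_def)
  ultimately show ?thesis
    using assms(1) sum_list_map_drop[of y k zs] by simp
qed

text \<open>
  Rotating a bridge by \<open>k\<close> moves the starting point to time \<open>k\<close>; the rotated bridge stays below its
  starting level iff the level at time \<open>k\<close> is the strict maximum.
\<close>

lemma block_ok_rotate_iff:
  fixes y :: "'i \<Rightarrow> real"
  assumes "sum_list (map y zs) = 0" "k < length zs"
  shows "block_ok y (\<lambda>t. t < 0) (rotate k zs) \<longleftrightarrow>
    (\<forall>i\<in>{..<length zs}. i \<noteq> k \<longrightarrow> sum_list (map y (take i zs)) < sum_list (map y (take k zs)))"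
    (is "?L \<longleftrightarrow> ?R")
proof
  assume L: ?L
  show ?R
  proof (intro ballI impI)
    fix i assume i: "i \<in> {..<length zs}" "i \<noteq> k"
    define m where "m = (if k < i then i - k else length zs + i - k)"
    have m: "0 < m" "m < length zs" "(k + m) mod length zs = i"
      using i assms by (auto simp: m_def)
    then show "sum_list (map y (take i zs)) < sum_list (map y (take k zs))"
      using L sum_list_take_rotate[OF assms m(2)] by (auto simp: block_ok_def)
  qed
next
  assume R: ?R
  show ?L
    unfolding block_ok_def
  proof (intro allI impI)
    fix i assume i: "0 < i \<and> i < length (rotate k zs)"
    then have "(k + i) mod length zs < length zs" "(k + i) mod length zs \<noteq> k"
      using assms by (cases "k + i < length zs"; auto simp: le_mod_geq)+
    then show "sum_list (map y (take i (rotate k zs))) < 0"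
      using R i sum_list_take_rotate[OF assms, of i] by auto
  qed
qed

lemma rotate_permutations_of_set:
  "bij_betw (rotate k) (permutations_of_set A) (permutations_of_set A)"
proof -
  have inj: "inj_on (rotate k) (permutations_of_set A)"
    unfolding rotate_def using inj_fn[OF inj_rotate1] by (rule inj_on_subset) simp
  have "rotate k ` permutations_of_set A \<subseteq> permutations_of_set A"
    by (auto simp: permutations_of_set_def)
  from endo_inj_surj[OF _ this inj] inj show ?thesis by (simp add: bij_betw_def)
qed

text \<open>
  By \<open>block_ok_rotate_iff\<close> each ordering of \<open>A\<close> has exactly one good rotation among its \<open>card A\<close>
  rotations, and each rotation permutes the set of all orderings. Double counting gives the good
  orderings a proportion of \<open>1 / card A\<close>.
\<close>

lemma card_negative_bridges:
  fixes y :: "'i \<Rightarrow> real"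
  assumes A: "finite A" "A \<noteq> {}" "sum y A = 0"
    and nz: "\<And>B. B \<in> permutations_of_set A \<Longrightarrow> block_ok y (\<lambda>t. t \<noteq> 0) B"
  shows "card {B \<in> permutations_of_set A. block_ok y (\<lambda>t. t < 0) B} = fact (card A - 1)"
proof -
  define G where "G = {B \<in> permutations_of_set A. block_ok y (\<lambda>t. t < 0) B}"
  let ?P = "\<lambda>zs i. sum_list (map y (take i zs))"
  have one: "card {k \<in> {..<card A}. rotate k zs \<in> G} = 1" if zs: "zs \<in> permutations_of_set A" for zs
  proof -
    have zs': "set zs = A" "distinct zs" "length zs = card A"
      using zs by (auto simp: permutations_of_set_def distinct_card)
    have s0: "sum_list (map y zs) = 0" using A(3) zs' by (simp add: sum_list_distinct_conv_sum_set)
    have rG: "rotate k zs \<in> permutations_of_set A" for k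
      using zs by (auto simp: permutations_of_set_def)
    have "?P zs a \<noteq> ?P zs b" if "a < b" "b < card A" for a b
    proof -
      have "?P (rotate a zs) (b - a) \<noteq> 0"
        using nz[OF rG[of a]] that zs' by (auto simp: block_ok_def)
      then show ?thesis
        using sum_list_take_rotate[OF s0, of a "b - a"] that zs' by simp
    qed
    then have "inj_on (?P zs) {..<card A}"
      by (metis (mono_tags, lifting) inj_onI lessThan_iff linorder_neqE_nat)
    then obtain k where "k \<in> {..<card A}" "\<And>i. i \<in> {..<card A} \<Longrightarrow>
        (\<forall>i'\<in>{..<card A}. i' \<noteq> i \<longrightarrow> ?P zs i' < ?P zs i) \<longleftrightarrow> i = k"
      using unique_strict_maximum[of "{..<card A}" "?P zs"] A by (auto simp: lessThan_empty_iff)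
    then have "{k \<in> {..<card A}. rotate k zs \<in> G} = {k}"
      using block_ok_rotate_iff[OF s0] rG zs' by (auto simp: G_def)
    then show ?thesis by simp
  qed
  have fact_A: "fact (card A) = card A * fact (card A - 1)"
    using A by (simp add: fact_reduce card_gt_0_iff)
  have "fact (card A) = (\<Sum>zs\<in>permutations_of_set A. card {k \<in> {..<card A}. rotate k zs \<in> G})"
    using A one by simp
  also have "\<dots> = (\<Sum>zs\<in>permutations_of_set A. \<Sum>k<card A. if rotate k zs \<in> G then 1 else 0)"
    by (simp add: sum.If_cases Int_def)
  also have "\<dots> = (\<Sum>k<card A. \<Sum>zs\<in>permutations_of_set A. if rotate k zs \<in> G then 1 else 0)"
    by (rule sum.swap)
  also have "\<dots> = (\<Sum>k<card A. \<Sum>zs\<in>permutations_of_set A. if zs \<in> G then 1 else 0)"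
    by (intro sum.cong refl sum.reindex_bij_betw[OF rotate_permutations_of_set, of "\<lambda>zs. if zs \<in> G then 1 else 0"])
  also have "\<dots> = card A * card G"
    by (simp add: sum.If_cases) (simp add: G_def Int_def conj_commute)
  finally show ?thesis using fact_A A by (simp add: G_def)
qed

lemma head_ok_tail_ok_iff:
  fixes y :: "'i \<Rightarrow> real"
  assumes "k \<le> length zs"
  shows "head_ok y (\<lambda>t. t < 0) (take k zs) \<and> tail_ok y (\<lambda>t. t < 0) (drop k zs) \<longleftrightarrow>
    (\<forall>i\<in>{..length zs}. i \<noteq> k \<longrightarrow> sum_list (map y (take i zs)) < sum_list (map y (take k zs)))"
    (is "?L \<longleftrightarrow> ?R")
proof
  assume L: ?L
  show ?R
  proof (intro ballI impI)
    fix i assume i: "i \<in> {..length zs}" "i \<noteq> k"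
    show "sum_list (map y (take i zs)) < sum_list (map y (take k zs))"
    proof (cases "i < k")
      case True
      then show ?thesis using L assms by (auto simp: head_ok_def sum_list_map_drop min_absorb1)
    next
      case False
      then have "0 < i - k" "i - k \<le> length (drop k zs)" using i assms by auto
      then have "sum_list (map y (take (i - k) (drop k zs))) < 0" using L unfolding tail_ok_def by blast
      then show ?thesis using False by (simp add: sum_list_take_drop)
    qed
  qed
next
  assume ?R
  then show ?L
    using assms by (auto simp: head_ok_def tail_ok_def sum_list_take_drop sum_list_map_drop min_absorb1)
qed

text \<open>
  A cut at time \<open>k\<close> is good iff the walk attains its strict maximum at time \<open>k\<close>. Nonvanishing sums
  make the levels distinct, so each ordering has exactly one good cut.
\<close>

lemma card_head_tail_splits:
  fixes y :: "'i \<Rightarrow> real"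
  assumes A: "finite A"
    and nz: "\<And>pre post. pre @ post \<in> permutations_of_set A \<Longrightarrow> tail_ok y (\<lambda>t. t \<noteq> 0) post"
  shows "card {(pre, post). pre @ post \<in> permutations_of_set A \<and>
      head_ok y (\<lambda>t. t < 0) pre \<and> tail_ok y (\<lambda>t. t < 0) post} = fact (card A)"
proof -
  define G where "G = {(pre, post). pre @ post \<in> permutations_of_set A \<and>
      head_ok y (\<lambda>t. t < 0) pre \<and> tail_ok y (\<lambda>t. t < 0) post}"
  let ?P = "\<lambda>zs i. sum_list (map y (take i zs))"
  have ex1: "\<exists>!k. k \<in> {..length zs} \<and> head_ok y (\<lambda>t. t < 0) (take k zs) \<and> tail_ok y (\<lambda>t. t < 0) (drop k zs)"
    if zs: "zs \<in> permutations_of_set A" for zs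
  proof -
    have "?P zs a \<noteq> ?P zs b" if "a < b" "b \<le> length zs" for a b
    proof -
      have "tail_ok y (\<lambda>t. t \<noteq> 0) (drop a zs)" using nz[of "take a zs" "drop a zs"] zs by simp
      then have "?P (drop a zs) (b - a) \<noteq> 0" using that by (auto simp: tail_ok_def)
      then show ?thesis using that by (simp add: sum_list_take_drop)
    qed
    then have "inj_on (?P zs) {..length zs}"
      by (metis (mono_tags, lifting) inj_onI atMost_iff linorder_neqE_nat)
    then have "\<exists>!k. k \<in> {..length zs} \<and> (\<forall>i\<in>{..length zs}. i \<noteq> k \<longrightarrow> ?P zs i < ?P zs k)"
      by (intro unique_strict_maximum) auto
    then show ?thesis using head_ok_tail_ok_iff[of _ zs y] by (metis (no_types, lifting) atMost_iff)
  qed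
  have "bij_betw (\<lambda>(pre, post). pre @ post) G (permutations_of_set A)"
  proof (rule bij_betwI')
    fix a b assume "a \<in> G" "b \<in> G"
    moreover obtain p q p' q' where ab: "a = (p, q)" "b = (p', q')" by fastforce
    ultimately have G: "(p, q) \<in> G" "(p', q') \<in> G" by auto
    have "p = p' \<and> q = q'" if eq: "p @ q = p' @ q'"
    proof -
      have "length p \<in> {..length (p @ q)} \<and> head_ok y (\<lambda>t. t < 0) (take (length p) (p @ q)) \<and>
          tail_ok y (\<lambda>t. t < 0) (drop (length p) (p @ q))"
        using G by (auto simp: G_def)
      moreover have "length p' \<in> {..length (p @ q)} \<and> head_ok y (\<lambda>t. t < 0) (take (length p') (p @ q)) \<and>
          tail_ok y (\<lambda>t. t < 0) (drop (length p') (p @ q))"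
        using G by (auto simp: G_def eq)
      ultimately have "length p = length p'" using ex1[of "p @ q"] G unfolding G_def by blast
      then show ?thesis using eq by simp
    qed
    then show "((case a of (pre, post) \<Rightarrow> pre @ post) = (case b of (pre, post) \<Rightarrow> pre @ post)) = (a = b)"
      by (auto simp: ab)
  next
    fix zs assume zs: "zs \<in> permutations_of_set A"
    then obtain k where "head_ok y (\<lambda>t. t < 0) (take k zs)" "tail_ok y (\<lambda>t. t < 0) (drop k zs)"
      using ex1 by blast
    then have "(take k zs, drop k zs) \<in> G" using zs by (simp add: G_def)
    then show "\<exists>x\<in>G. zs = (case x of (pre, post) \<Rightarrow> pre @ post)" by force
  qed (auto simp: G_def)
  then have "card G = card (permutations_of_set A)" by (rule bij_betw_same_card)
  then show ?thesis using A by (simp add: G_def)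
qed

section \<open>Stirling numbers and ordered families of blocks\<close>

text \<open>
  These are the coefficients of the power series \<open>(- ln (1 - t)) ^ j / (1 - t)\<close>.
\<close>

definition stirling_ratio :: "nat \<Rightarrow> nat \<Rightarrow> real" where
  "stirling_ratio j n = fact j * real (stirling (n + 1) (j + 1)) / fact n"

lemma stirling_ratio_0: "stirling_ratio 0 n = 1"
  by (simp add: stirling_ratio_def stirling_Suc_n_1 del: stirling.simps)

lemma stirling_ratio_Suc_Suc:
  "(real n + 1) * stirling_ratio (Suc j) (Suc n) =
     (real n + 1) * stirling_ratio (Suc j) n + (real j + 1) * stirling_ratio j n"
proof -
  define N a b where "N = real n + 1" and "a = real (stirling (n + 1) (Suc j + 1))"
    and "b = real (stirling (n + 1) (j + 1))"
  have "real (stirling (Suc n + 1) (Suc j + 1)) = N * a + b"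
    by (simp add: N_def a_def b_def algebra_simps)
  moreover have "N \<noteq> 0" "(fact (Suc n) :: real) = N * fact n" "(fact (Suc j) :: real) = (real j + 1) * fact j"
    by (auto simp: N_def)
  ultimately show ?thesis
    unfolding stirling_ratio_def N_def[symmetric] a_def[symmetric] b_def[symmetric]
    by (simp add: field_simps del: fact_Suc of_nat_Suc)
qed

lemma stirling_ratio_rec:
  "(real n + 1) * stirling_ratio j (Suc n) =
     (real n + 1) * stirling_ratio j n + real j * stirling_ratio (j - 1) n"
  using stirling_ratio_Suc_Suc[of n "j - 1"] by (cases j) (auto simp: stirling_ratio_0 add.commute)

text \<open>
  The coefficient form of multiplying by \<open>- ln (1 - t) = (\<Sum>l\<ge>1. t ^ l / l)\<close>. It is proved by checking
  that the convolution \<open>D\<close> satisfies the recursion \<open>stirling_ratio_Suc_Suc\<close> in \<open>n\<close>: in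
  \<open>(n + 1) D (n + 1)\<close> the factor \<open>n + 1 = (n + 1 - k) + k\<close> is split, and the part with \<open>k\<close> is handled by
  the recursion for index \<open>j\<close> and the induction hypothesis.
\<close>

lemma stirling_ratio_Suc: "stirling_ratio (Suc j) n = (\<Sum>k<n. stirling_ratio j k / real (n - k))"
proof (induction j arbitrary: n rule: less_induct)
  case (less j)
  have frac: "c * (x / a) = x + b * x / a" if "a \<noteq> 0" "c = a + b" for a b c x :: real
    using that by (simp add: field_simps)
  define D where "D n = (\<Sum>k<n. stirling_ratio j k / real (n - k))" for n
  have prev: "(\<Sum>i<n. real j * stirling_ratio (j - 1) i / real (n - i)) = real j * stirling_ratio j n" for n
    using less.IH[of "j - 1" n] by (cases j) (auto simp: sum_distrib_left)
  have step: "(real n + 1) * D (Suc n) = (real n + 1) * D n + (real j + 1) * stirling_ratio j n" for n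
  proof -
    have "(real n + 1) * D (Suc n) =
        (\<Sum>k<Suc n. stirling_ratio j k + real k * stirling_ratio j k / real (Suc n - k))"
      unfolding D_def sum_distrib_left
    proof (rule sum.cong)
      fix k assume "k \<in> {..<Suc n}"
      then have "real (Suc n - k) \<noteq> 0" "real n + 1 = real (Suc n - k) + real k" by auto
      then show "(real n + 1) * (stirling_ratio j k / real (Suc n - k)) =
          stirling_ratio j k + real k * stirling_ratio j k / real (Suc n - k)"
        by (rule frac)
    qed simp
    also have "\<dots> = (\<Sum>k<Suc n. stirling_ratio j k) +
        (\<Sum>i<n. (real i + 1) * stirling_ratio j (Suc i) / real (n - i))"
      unfolding sum.distrib by (subst (2) sum.lessThan_Suc_shift) (simp add: add.commute)
    also have "(\<Sum>i<n. (real i + 1) * stirling_ratio j (Suc i) / real (n - i)) =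
        (\<Sum>i<n. (real i + 1) * stirling_ratio j i / real (n - i)) + real j * stirling_ratio j n"
      unfolding stirling_ratio_rec add_divide_distrib sum.distrib prev ..
    also have "(\<Sum>i<n. (real i + 1) * stirling_ratio j i / real (n - i)) =
        (\<Sum>i<n. (real n + 1) * (stirling_ratio j i / real (n - i)) - stirling_ratio j i)"
    proof (rule sum.cong)
      fix i assume "i \<in> {..<n}"
      then have "real (n - i) \<noteq> 0" "real n + 1 = real (n - i) + (real i + 1)" by auto
      then show "(real i + 1) * stirling_ratio j i / real (n - i) =
          (real n + 1) * (stirling_ratio j i / real (n - i)) - stirling_ratio j i"
        using frac[of "real (n - i)" "real n + 1" "real i + 1" "stirling_ratio j i"] by linarith
    qed simp
    also have "\<dots> = (real n + 1) * D n - (\<Sum>i<n. stirling_ratio j i)"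
      by (simp add: sum_subtractf D_def sum_distrib_left)
    finally show ?thesis by (simp add: algebra_simps)
  qed
  have "D n = stirling_ratio (Suc j) n"
  proof (induction n)
    case 0
    show ?case by (simp add: D_def stirling_ratio_def)
  next
    case (Suc n)
    then have "(real n + 1) * D (Suc n) = (real n + 1) * stirling_ratio (Suc j) (Suc n)"
      by (simp only: step stirling_ratio_Suc_Suc)
    then show ?case by (simp add: add_eq_0_iff)
  qed
  then show ?case by (simp add: D_def)
qed

text \<open>
  The ordered families of \<open>j\<close> disjoint nonempty subsets of \<open>U\<close>.
\<close>

fun block_lists :: "nat \<Rightarrow> 'i set \<Rightarrow> 'i set list set" where
  "block_lists 0 U = {[]}"
| "block_lists (Suc j) U = (\<Union>A\<in>{A. A \<subseteq> U \<and> A \<noteq> {}}. (#) A ` block_lists j (U - A))"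

lemma finite_block_lists: "finite U \<Longrightarrow> finite (block_lists j U)"
  by (induction j arbitrary: U) auto

lemma block_listsD:
  "As \<in> block_lists j U \<Longrightarrow> A \<in> set As \<Longrightarrow> A \<subseteq> U \<and> A \<noteq> {}"
proof (induction j arbitrary: U As)
  case (Suc j)
  then obtain A' As' where As: "As = A' # As'" "A' \<subseteq> U" "A' \<noteq> {}" "As' \<in> block_lists j (U - A')"
    by auto
  show ?case using Suc.IH[OF As(4)] Suc.prems(2) As by auto
qed simp

text \<open>
  Splitting off the first block, of size \<open>l\<close>, contributes \<open>(n choose l) (l - 1)! (n - l)! = n! / l\<close>; what
  remains is the convolution in \<open>stirling_ratio_Suc\<close>.
\<close>

lemma sum_over_block_lists:
  assumes "finite U"
  shows "(\<Sum>As\<in>block_lists j U. real (prod_list (map (\<lambda>A. fact (card A - 1)) As) * fact (card (U - \<Union>(set As))))) =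
    fact j * real (stirling (card U + 1) (j + 1))"
  using assms
proof (induction j arbitrary: U)
  case 0
  then show ?case by (simp add: stirling_Suc_n_1 del: stirling.simps)
next
  case (Suc j)
  define w :: "'a set \<Rightarrow> 'a set list \<Rightarrow> real" where
    "w U As = real (prod_list (map (\<lambda>A. fact (card A - 1)) As) * fact (card (U - \<Union>(set As))))" for U As
  let ?n = "card U"
  let ?N = "{A. A \<subseteq> U \<and> A \<noteq> {}}"
  have fin: "finite ?N" using Suc.prems by simp
  define g where "g l = fact (l - 1) * (fact (?n - l) * stirling_ratio j (?n - l))" for l
  have "(\<Sum>As\<in>block_lists (Suc j) U. w U As) = (\<Sum>A\<in>?N. \<Sum>As\<in>(#) A ` block_lists j (U - A). w U As)"
    unfolding block_lists.simps
    by (rule sum.UNION_disjoint) (use fin Suc.prems in \<open>auto intro!: finite_imageI finite_block_lists\<close>)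
  also have "\<dots> = (\<Sum>A\<in>?N. g (card A))"
  proof (rule sum.cong)
    fix A assume A: "A \<in> ?N"
    then have "finite A" using Suc.prems finite_subset by blast
    with A have fA: "finite A" "finite (U - A)" "card (U - A) = ?n - card A"
      using Suc.prems by (auto simp: card_Diff_subset)
    have "w U (A # As) = fact (card A - 1) * w (U - A) As" for As
      by (simp add: w_def Diff_eq Int_assoc)
    then have "(\<Sum>As\<in>(#) A ` block_lists j (U - A). w U As) = fact (card A - 1) * (\<Sum>As\<in>block_lists j (U - A). w (U - A) As)"
      by (subst sum.reindex) (auto simp: sum_distrib_left)
    also have "\<dots> = g (card A)"
      using Suc.IH[OF fA(2)] by (simp add: w_def g_def stirling_ratio_def fA)
    finally show "(\<Sum>As\<in>(#) A ` block_lists j (U - A). w U As) = g (card A)" .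
  qed simp
  also have "\<dots> = (\<Sum>l=1..?n. \<Sum>A | A \<in> ?N \<and> card A = l. g (card A))"
    using fin Suc.prems
    by (intro sum.group[symmetric]) (auto simp: card_mono Suc_le_eq card_gt_0_iff dest: finite_subset)
  also have "\<dots> = (\<Sum>l=1..?n. real (?n choose l) * g l)"
  proof (rule sum.cong)
    fix l assume "l \<in> {1..?n}"
    then have "{A \<in> ?N. card A = l} = {A. A \<subseteq> U \<and> card A = l}" by auto
    then show "(\<Sum>A | A \<in> ?N \<and> card A = l. g (card A)) = real (?n choose l) * g l"
      using n_subsets[OF Suc.prems] by simp
  qed simp
  also have "\<dots> = (\<Sum>l=1..?n. fact ?n * (stirling_ratio j (?n - l) / real l))"
  proof (rule sum.cong)
    fix l assume l: "l \<in> {1..?n}"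
    have "fact ?n = real (?n choose l) * (fact l * fact (?n - l))"
      using l by (simp add: binomial_fact)
    moreover have "(fact l :: real) = real l * fact (l - 1)" using l by (simp add: fact_reduce)
    ultimately show "real (?n choose l) * g l = fact ?n * (stirling_ratio j (?n - l) / real l)"
      using l by (simp add: g_def)
  qed simp
  also have "\<dots> = fact ?n * (\<Sum>k<?n. stirling_ratio j k / real (?n - k))"
    unfolding sum_distrib_left
    by (rule sum.reindex_bij_witness[of _ "\<lambda>k. ?n - k" "\<lambda>l. ?n - l"]) auto
  also have "\<dots> = fact (Suc j) * real (stirling (?n + 1) (Suc j + 1))"
    by (simp only: stirling_ratio_Suc[symmetric]) (simp add: stirling_ratio_def del: stirling.simps)
  finally show ?case by (simp add: w_def del: block_lists.simps)
qed

section \<open>Counting the good splittings of all orderings\<close>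

text \<open>
  The orderings of \<open>U\<close> together with a decomposition into a head, \<open>j\<close> nonempty blocks and a tail.
\<close>

definition splits :: "nat \<Rightarrow> 'i set \<Rightarrow> ('i list \<times> 'i list list \<times> 'i list) set" where
  "splits j U = {(pre, Bs, post). pre @ concat Bs @ post \<in> permutations_of_set U \<and>
     length Bs = j \<and> [] \<notin> set Bs}"

definition split_ok :: "('i \<Rightarrow> real) \<Rightarrow> (real \<Rightarrow> bool) \<Rightarrow> 'i list \<times> 'i list list \<times> 'i list \<Rightarrow> bool" where
  "split_ok y Q = (\<lambda>(pre, Bs, post). head_ok y Q pre \<and> (\<forall>B\<in>set Bs. block_ok y Q B) \<and> tail_ok y Q post)"

abbreviation blocks :: "'i list \<times> 'i list list \<times> 'i list \<Rightarrow> 'i set list" where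
  "blocks x \<equiv> map set (fst (snd x))"

lemma map_set_in_block_lists_iff:
  "map set Bs \<in> block_lists j U \<and> (\<forall>B\<in>set Bs. distinct B) \<longleftrightarrow>
     length Bs = j \<and> [] \<notin> set Bs \<and> distinct (concat Bs) \<and> set (concat Bs) \<subseteq> U"
proof (induction Bs arbitrary: j U)
  case Nil
  show ?case by (cases j) auto
next
  case (Cons B Bs)
  show ?case
  proof (cases j)
    case (Suc i)
    have "map set (B # Bs) \<in> block_lists j U \<longleftrightarrow>
        set B \<subseteq> U \<and> B \<noteq> [] \<and> map set Bs \<in> block_lists i (U - set B)"
      by (auto simp: Suc)
    then have "map set (B # Bs) \<in> block_lists j U \<and> (\<forall>B\<in>set (B # Bs). distinct B) \<longleftrightarrow>
        set B \<subseteq> U \<and> B \<noteq> [] \<and> distinct B \<and>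
        (map set Bs \<in> block_lists i (U - set B) \<and> (\<forall>B\<in>set Bs. distinct B))"
      by simp blast
    also have "\<dots> \<longleftrightarrow> set B \<subseteq> U \<and> B \<noteq> [] \<and> distinct B \<and>
        (length Bs = i \<and> [] \<notin> set Bs \<and> distinct (concat Bs) \<and> set (concat Bs) \<subseteq> U - set B)"
      by (simp only: Cons.IH)
    also have "\<dots> \<longleftrightarrow> length (B # Bs) = j \<and> [] \<notin> set (B # Bs) \<and>
        distinct (concat (B # Bs)) \<and> set (concat (B # Bs)) \<subseteq> U"
      by (auto simp: Suc)
    finally show ?thesis .
  qed auto
qed

lemma splits_iff:
  "(pre, Bs, post) \<in> splits j U \<longleftrightarrow> map set Bs \<in> block_lists j U \<and> (\<forall>B\<in>set Bs. distinct B) \<and>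
     pre @ post \<in> permutations_of_set (U - \<Union>(set (map set Bs)))"
proof -
  have "(pre, Bs, post) \<in> splits j U \<longleftrightarrow>
      (length Bs = j \<and> [] \<notin> set Bs \<and> distinct (concat Bs) \<and> set (concat Bs) \<subseteq> U) \<and>
      pre @ post \<in> permutations_of_set (U - set (concat Bs))"
    by (auto simp: splits_def permutations_of_set_def)
  then show ?thesis
    unfolding map_set_in_block_lists_iff[symmetric] by (simp add: conj_assoc)
qed

text \<open>
  Used to see the splittings with prescribed block sets as a product: the blocks can be
  ordered independently of each other and of the head and tail.
\<close>

lemma list_all2_permutations_iff:
  "list_all2 (\<lambda>B A. B \<in> permutations_of_set A) Bs As \<longleftrightarrow> map set Bs = As \<and> (\<forall>B\<in>set Bs. distinct B)"
  by (induction Bs arbitrary: As) (auto simp: list_all2_Cons1 permutations_of_set_def)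

lemma
  assumes "\<And>A. A \<in> set As \<Longrightarrow> finite {B. P B A}"
  shows finite_list_all2: "finite {Bs. list_all2 P Bs As}"
    and card_list_all2: "card {Bs. list_all2 P Bs As} = prod_list (map (\<lambda>A. card {B. P B A}) As)"
proof -
  have "finite {Bs. list_all2 P Bs As} \<and>
      card {Bs. list_all2 P Bs As} = prod_list (map (\<lambda>A. card {B. P B A}) As)"
    using assms
  proof (induction As)
    case (Cons A As)
    have "{Bs. list_all2 P Bs (A # As)} = (\<lambda>(B, Bs). B # Bs) ` ({B. P B A} \<times> {Bs. list_all2 P Bs As})"
      by (auto simp: list_all2_Cons2)
    moreover have "inj_on (\<lambda>(B, Bs). B # Bs) ({B. P B A} \<times> {Bs. list_all2 P Bs As})"
      by (auto simp: inj_on_def)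
    ultimately show ?case using Cons by (simp add: card_image card_cartesian_product)
  qed simp
  then show "finite {Bs. list_all2 P Bs As}"
    "card {Bs. list_all2 P Bs As} = prod_list (map (\<lambda>A. card {B. P B A}) As)" by auto
qed

lemma
  fixes y :: "'i \<Rightarrow> real"
  assumes U: "finite U" and As: "As \<in> block_lists j U"
    and zero: "\<And>A. A \<in> set As \<Longrightarrow> sum y A = 0"
    and nz: "\<And>x. x \<in> splits j U \<Longrightarrow> blocks x = As \<Longrightarrow> split_ok y (\<lambda>t. t \<noteq> 0) x"
  shows finite_negative_splits_fixed_blocks:
      "finite {x \<in> splits j U. blocks x = As \<and> split_ok y (\<lambda>t. t < 0) x}"
    and card_negative_splits_fixed_blocks:
      "card {x \<in> splits j U. blocks x = As \<and> split_ok y (\<lambda>t. t < 0) x} =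
        prod_list (map (\<lambda>A. fact (card A - 1)) As) * fact (card (U - \<Union>(set As)))"
proof -
  let ?R = "U - \<Union>(set As)"
  have mem: "(pre, Bs, post) \<in> splits j U \<and> map set Bs = As \<longleftrightarrow>
      list_all2 (\<lambda>B A. B \<in> permutations_of_set A) Bs As \<and> pre @ post \<in> permutations_of_set ?R" for pre Bs post
    using As by (auto simp: splits_iff list_all2_permutations_iff)
  have fA: "finite A" "A \<noteq> {}" if "A \<in> set As" for A
    using block_listsD[OF As that] U finite_subset by auto
  have "\<forall>A\<in>set As. \<exists>B. B \<in> permutations_of_set A"
    using fA permutations_of_set_empty_iff by blast
  then obtain c where c: "\<And>A. A \<in> set As \<Longrightarrow> c A \<in> permutations_of_set A" by metis
  have c_all: "list_all2 (\<lambda>B A. B \<in> permutations_of_set A) (map c As) As"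
    using c by (auto simp: list_all2_conv_all_nth)
  obtain r where r: "r \<in> permutations_of_set ?R"
    using U permutations_of_set_empty_iff[of ?R] by blast
  \<comment> \<open>Any ordering of one block extends to a splitting with block sets As, so that nz applies to it.\<close>
  have nz_block: "block_ok y (\<lambda>t. t \<noteq> 0) B" if "A \<in> set As" "B \<in> permutations_of_set A" for A B
  proof -
    obtain k where k: "k < length As" "As ! k = A" using \<open>A \<in> set As\<close> by (auto simp: in_set_conv_nth)
    have "list_all2 (\<lambda>B A. B \<in> permutations_of_set A) ((map c As)[k := B]) As"
      using c_all k that by (auto simp: list_all2_conv_all_nth nth_list_update)
    then have "([], (map c As)[k := B], r) \<in> splits j U \<and> map set ((map c As)[k := B]) = As"
      using mem r by simp
    then have "split_ok y (\<lambda>t. t \<noteq> 0) ([], (map c As)[k := B], r)" using nz by fastforce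
    moreover have "B \<in> set ((map c As)[k := B])" using k by (simp add: set_update_memI)
    ultimately show ?thesis unfolding split_ok_def by blast
  qed
  have nz_tail: "tail_ok y (\<lambda>t. t \<noteq> 0) post" if "pre @ post \<in> permutations_of_set ?R" for pre post
    using nz[of "(pre, map c As, post)"] mem[of pre "map c As" post] c_all that by (auto simp: split_ok_def)
  define L where "L = {Bs. list_all2 (\<lambda>B A. B \<in> permutations_of_set A \<and> block_ok y (\<lambda>t. t < 0) B) Bs As}"
  define H where "H = {(pre, post). pre @ post \<in> permutations_of_set ?R \<and>
      head_ok y (\<lambda>t. t < 0) pre \<and> tail_ok y (\<lambda>t. t < 0) post}"
  have L: "Bs \<in> L \<longleftrightarrow> list_all2 (\<lambda>B A. B \<in> permutations_of_set A) Bs As \<and> (\<forall>B\<in>set Bs. block_ok y (\<lambda>t. t < 0) B)" for Bs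
    by (auto simp: L_def list_all2_conv_all_nth all_set_conv_all_nth)
  have eq: "{x \<in> splits j U. blocks x = As \<and> split_ok y (\<lambda>t. t < 0) x} =
      (\<lambda>(Bs, pre, post). (pre, Bs, post)) ` (L \<times> H)"
  proof (intro set_eqI)
    fix x :: "'i list \<times> 'i list list \<times> 'i list"
    obtain pre Bs post where x: "x = (pre, Bs, post)" by (cases x) auto
    have "x \<in> {x \<in> splits j U. blocks x = As \<and> split_ok y (\<lambda>t. t < 0) x} \<longleftrightarrow> Bs \<in> L \<and> (pre, post) \<in> H"
      using mem[of pre Bs post] by (auto simp: x L H_def split_ok_def)
    also have "\<dots> \<longleftrightarrow> x \<in> (\<lambda>(Bs, pre, post). (pre, Bs, post)) ` (L \<times> H)"
      by (force simp: x)
    finally show "x \<in> {x \<in> splits j U. blocks x = As \<and> split_ok y (\<lambda>t. t < 0) x} \<longleftrightarrow>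
      x \<in> (\<lambda>(Bs, pre, post). (pre, Bs, post)) ` (L \<times> H)" .
  qed
  have finite_blocks: "finite {B. B \<in> permutations_of_set A \<and> block_ok y (\<lambda>t. t < 0) B}" for A :: "'i set"
    by simp
  have finL: "finite L" unfolding L_def by (rule finite_list_all2) (rule finite_blocks)
  have "card L = prod_list (map (\<lambda>A. card {B \<in> permutations_of_set A. block_ok y (\<lambda>t. t < 0) B}) As)"
    unfolding L_def by (rule card_list_all2) (rule finite_blocks)
  also have "\<dots> = prod_list (map (\<lambda>A. fact (card A - 1)) As)"
    using card_negative_bridges[OF fA zero nz_block]
    by (intro arg_cong[of _ _ prod_list] map_cong) auto
  finally have cL: "card L = prod_list (map (\<lambda>A. fact (card A - 1)) As)" .
  have cH: "card H = fact (card ?R)"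
    unfolding H_def using U nz_tail by (intro card_head_tail_splits) auto
  then have finH: "finite H" by (metis card.infinite fact_nonzero)
  show "finite {x \<in> splits j U. blocks x = As \<and> split_ok y (\<lambda>t. t < 0) x}"
    unfolding eq using finL finH by auto
  have "inj_on (\<lambda>(Bs, pre, post). (pre, Bs, post)) (L \<times> H)" by (auto simp: inj_on_def)
  then show "card {x \<in> splits j U. blocks x = As \<and> split_ok y (\<lambda>t. t < 0) x} =
        prod_list (map (\<lambda>A. fact (card A - 1)) As) * fact (card (U - \<Union>(set As)))"
    unfolding eq by (simp add: card_image card_cartesian_product cL cH)
qed

text \<open>
  The increments \<open>y\<close> may depend on the splitting, but only through the sets of its blocks. The
  splittings are therefore grouped by their block sets.
\<close>

lemma card_negative_splits:
  fixes y :: "'i set list \<Rightarrow> 'i \<Rightarrow> real"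
  assumes U: "finite U"
    and zero: "\<And>As A. As \<in> block_lists j U \<Longrightarrow> A \<in> set As \<Longrightarrow> sum (y As) A = 0"
    and nz: "\<And>x. x \<in> splits j U \<Longrightarrow> split_ok (y (blocks x)) (\<lambda>t. t \<noteq> 0) x"
  shows "real (card {x \<in> splits j U. split_ok (y (blocks x)) (\<lambda>t. t < 0) x}) =
    fact j * real (stirling (card U + 1) (j + 1))"
proof -
  define X where "X As = {x \<in> splits j U. blocks x = As \<and> split_ok (y As) (\<lambda>t. t < 0) x}" for As
  have "blocks x \<in> block_lists j U" if "x \<in> splits j U" for x
    using that splits_iff[of "fst x" "fst (snd x)" "snd (snd x)" j U] by simp
  then have "{x \<in> splits j U. split_ok (y (blocks x)) (\<lambda>t. t < 0) x} = (\<Union>As\<in>block_lists j U. X As)"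
    by (auto simp: X_def)
  moreover have "card (\<Union>As\<in>block_lists j U. X As) = (\<Sum>As\<in>block_lists j U. card (X As))"
  proof (rule card_UN_disjoint)
    show "\<forall>As\<in>block_lists j U. finite (X As)"
      unfolding X_def using zero nz by (intro ballI finite_negative_splits_fixed_blocks U) auto
  qed (use U finite_block_lists in \<open>auto simp: X_def\<close>)
  moreover have "card (X As) = prod_list (map (\<lambda>A. fact (card A - 1)) As) * fact (card (U - \<Union>(set As)))"
    if "As \<in> block_lists j U" for As
    unfolding X_def using that zero nz by (intro card_negative_splits_fixed_blocks U) auto
  ultimately show ?thesis
    using sum_over_block_lists[OF U, of j] by simp
qed

section \<open>Vertex index sets as cut positions\<close>

text \<open>
  The times at which the blocks \<open>Bs\<close> start and end when the first of them starts at time \<open>a\<close>.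
\<close>

fun cuts :: "nat \<Rightarrow> 'i list list \<Rightarrow> nat list" where
  "cuts a [] = [a]"
| "cuts a (B # Bs) = a # cuts (a + length B) Bs"

lemma length_cuts: "length (cuts a Bs) = Suc (length Bs)"
  by (induction Bs arbitrary: a) auto

lemma hd_cuts: "hd (cuts a Bs) = a" and cuts_nonempty [simp]: "cuts a Bs \<noteq> []"
  by (cases Bs; simp)+

lemma cuts_bounds: "i \<in> set (cuts a Bs) \<Longrightarrow> a \<le> i \<and> i \<le> a + length (concat Bs)"
  by (induction Bs arbitrary: a) fastforce+

lemma cuts_start: "a \<in> set (cuts a Bs)"
  by (cases Bs) auto

lemma sorted_cuts: "[] \<notin> set Bs \<Longrightarrow> sorted_wrt (<) (cuts a Bs)"
proof (induction Bs arbitrary: a)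
  case (Cons B Bs)
  have "a < i" if "i \<in> set (cuts (a + length B) Bs)" for i
    using cuts_bounds[OF that] Cons.prems by (cases B) auto
  with Cons show ?case by simp
qed simp

lemma cuts_inject:
  "cuts a Bs = cuts a Bs' \<Longrightarrow> concat Bs @ post = concat Bs' @ post' \<Longrightarrow> Bs = Bs' \<and> post = post'"
proof (induction Bs arbitrary: a Bs')
  case Nil
  have "Bs' = []"
  proof (rule ccontr)
    assume "Bs' \<noteq> []"
    then have "length Bs' \<noteq> 0" by simp
    moreover have "length Bs' = 0" using arg_cong[OF Nil(1), of length] by (simp add: length_cuts)
    ultimately show False by simp
  qed
  with Nil show ?case by simp
next
  case (Cons B Bs)
  then obtain B' Cs where Bs': "Bs' = B' # Cs" by (cases Bs') auto
  then have c: "cuts (a + length B) Bs = cuts (a + length B') Cs" using Cons.prems by simp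
  then have "length B = length B'" by (metis add_left_imp_eq hd_cuts)
  then show ?case using Cons.IH[of "a + length B" Cs] Cons.prems c Bs' by auto
qed

lemma cuts_surj:
  "sorted_wrt (<) (a # js) \<Longrightarrow> (\<And>i. i \<in> set js \<Longrightarrow> i \<le> a + length ys) \<Longrightarrow>
     \<exists>Bs post. ys = concat Bs @ post \<and> [] \<notin> set Bs \<and> cuts a Bs = a # js"
proof (induction js arbitrary: a ys)
  case Nil
  then show ?case by (intro exI[of _ "[]"] exI[of _ ys]) simp
next
  case (Cons b js)
  have ab: "a < b" "b \<le> a + length ys" using Cons.prems by auto
  have "i \<le> b + length (drop (b - a) ys)" if "i \<in> set js" for i
    using Cons.prems(2)[of i] that ab by simp
  then have "\<exists>Bs post. drop (b - a) ys = concat Bs @ post \<and> [] \<notin> set Bs \<and> cuts b Bs = b # js"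
    using Cons.prems(1) by (intro Cons.IH) auto
  then obtain Bs post where Bs: "drop (b - a) ys = concat Bs @ post" "[] \<notin> set Bs" "cuts b Bs = b # js"
    by blast
  show ?case
  proof (intro exI conjI)
    show "ys = concat (take (b - a) ys # Bs) @ post"
      using append_take_drop_id[of "b - a" ys] Bs(1) by simp
    show "[] \<notin> set (take (b - a) ys # Bs)" using Bs ab by auto
    show "cuts a (take (b - a) ys # Bs) = a # b # js" using Bs ab by (simp add: min_absorb2)
  qed
qed

lemma ball_le_split_iff:
  fixes m n :: nat
  shows "(\<forall>i\<le>m + n. R i) \<longleftrightarrow> (\<forall>i<m. R i) \<and> (\<forall>i\<le>n. R (m + i))"
proof (intro iffI allI impI conjI)
  fix i assume *: "(\<forall>i<m. R i) \<and> (\<forall>i\<le>n. R (m + i))" "i \<le> m + n"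
  show "R i"
  proof (cases "i < m")
    case False
    then have "i = m + (i - m)" "i - m \<le> n" using * by auto
    then show ?thesis using * by metis
  qed (use * in auto)
qed auto

lemma block_tail_ok_iff:
  fixes y :: "'i \<Rightarrow> real"
  assumes "[] \<notin> set Bs" "\<And>B. B \<in> set Bs \<Longrightarrow> sum_list (map y B) = 0"
  shows "(\<forall>i\<le>length (concat Bs @ post). a + i \<notin> set (cuts a Bs) \<longrightarrow>
            Q (sum_list (map y (take i (concat Bs @ post))))) \<longleftrightarrow>
         (\<forall>B\<in>set Bs. block_ok y Q B) \<and> tail_ok y Q post"
  using assms
proof (induction Bs arbitrary: a)
  case Nil
  show ?case by (auto simp: tail_ok_def)
next
  case (Cons B Bs)
  let ?ys = "concat Bs @ post"
  let ?c = "\<lambda>i. a + i \<notin> set (cuts a (B # Bs)) \<longrightarrow> Q (sum_list (map y (take i (concat (B # Bs) @ post))))"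
  have B: "B \<noteq> []" "sum_list (map y B) = 0" using Cons.prems by auto
  have "(\<forall>i\<le>length (concat (B # Bs) @ post). ?c i) \<longleftrightarrow>
      (\<forall>i<length B. ?c i) \<and> (\<forall>i\<le>length ?ys. ?c (length B + i))"
    using ball_le_split_iff[of "length B" "length ?ys" ?c] by (simp add: add.assoc)
  also have "(\<forall>i<length B. ?c i) \<longleftrightarrow> block_ok y Q B"
  proof -
    have "?c i \<longleftrightarrow> (0 < i \<longrightarrow> Q (sum_list (map y (take i B))))" if "i < length B" for i
      using that cuts_bounds[of "a + i" "a + length B" Bs] by auto
    then show ?thesis by (auto simp: block_ok_def)
  qed
  also have "(\<forall>i\<le>length ?ys. ?c (length B + i)) \<longleftrightarrow>
      (\<forall>i\<le>length ?ys. (a + length B) + i \<notin> set (cuts (a + length B) Bs) \<longrightarrow> Q (sum_list (map y (take i ?ys))))"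
    using B by (simp add: add.assoc)
  also have "\<dots> \<longleftrightarrow> (\<forall>B\<in>set Bs. block_ok y Q B) \<and> tail_ok y Q post"
    using Cons.prems by (intro Cons.IH) auto
  finally show ?case by auto
qed

text \<open>
  All cut positions have the same level because the blocks have sum zero. So the condition on the
  whole walk at the times that are not cut positions separates into conditions on the pieces.
\<close>

lemma split_ok_iff:
  fixes y :: "'i \<Rightarrow> real" and pre post :: "'i list"
  assumes "[] \<notin> set Bs" "\<And>B. B \<in> set Bs \<Longrightarrow> sum_list (map y B) = 0"
  defines "zs \<equiv> pre @ concat Bs @ post"
  shows "split_ok y Q (pre, Bs, post) \<longleftrightarrow>
    (\<forall>i\<in>{0..length zs} - set (cuts (length pre) Bs).
       Q (sum_list (map y (take i zs)) - sum_list (map y (take (length pre) zs))))"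
proof -
  let ?l = "length pre" and ?ys = "concat Bs @ post"
  let ?c = "\<lambda>i. i \<notin> set (cuts ?l Bs) \<longrightarrow>
       Q (sum_list (map y (take i zs)) - sum_list (map y (take ?l zs)))"
  have "(\<forall>i\<in>{0..length zs} - set (cuts ?l Bs).
       Q (sum_list (map y (take i zs)) - sum_list (map y (take ?l zs)))) \<longleftrightarrow> (\<forall>i\<le>?l + length ?ys. ?c i)"
    by (auto simp: zs_def)
  also have "\<dots> \<longleftrightarrow> (\<forall>i<?l. ?c i) \<and> (\<forall>i\<le>length ?ys. ?c (?l + i))"
    by (rule ball_le_split_iff)
  also have "(\<forall>i<?l. ?c i) \<longleftrightarrow> head_ok y Q pre"
  proof -
    have "?c i \<longleftrightarrow> Q (- sum_list (map y (drop i pre)))" if "i < ?l" for i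
      using that cuts_bounds[of i ?l Bs] sum_list_map_drop[of y i pre] by (auto simp: zs_def)
    then show ?thesis by (auto simp: head_ok_def)
  qed
  also have "(\<forall>i\<le>length ?ys. ?c (?l + i)) \<longleftrightarrow> (\<forall>B\<in>set Bs. block_ok y Q B) \<and> tail_ok y Q post"
    using block_tail_ok_iff[OF assms(1,2), of post ?l Q] by (simp add: zs_def)
  finally show ?thesis by (simp add: split_ok_def)
qed

lemma walk_constant_on_cuts_iff:
  fixes y :: "'i \<Rightarrow> real"
  shows "(\<forall>i\<in>set (cuts a Bs). sum_list (map y (take (i - a) (concat Bs @ post))) = 0) \<longleftrightarrow>
    (\<forall>B\<in>set Bs. sum_list (map y B) = 0)"
proof (induction Bs arbitrary: a)
  case (Cons B Bs)
  let ?ys = "concat Bs @ post" and ?C = "set (cuts (a + length B) Bs)"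
  have "sum_list (map y (take (i - a) (B @ ?ys))) =
      sum_list (map y B) + sum_list (map y (take (i - (a + length B)) ?ys))" if "i \<in> ?C" for i
  proof -
    have "length B \<le> i - a" using cuts_bounds[OF that] by linarith
    then show ?thesis by simp
  qed
  then have "(\<forall>i\<in>set (cuts a (B # Bs)). sum_list (map y (take (i - a) (concat (B # Bs) @ post))) = 0) \<longleftrightarrow>
      (\<forall>i\<in>?C. sum_list (map y B) + sum_list (map y (take (i - (a + length B)) ?ys)) = 0)"
    by simp
  also have "\<dots> \<longleftrightarrow> sum_list (map y B) = 0 \<and> (\<forall>i\<in>?C. sum_list (map y (take (i - (a + length B)) ?ys)) = 0)"
  proof (intro iffI conjI)
    assume *: "\<forall>i\<in>?C. sum_list (map y B) + sum_list (map y (take (i - (a + length B)) ?ys)) = 0"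
    from bspec[OF this cuts_start] show "sum_list (map y B) = 0" by simp
    with * show "\<forall>i\<in>?C. sum_list (map y (take (i - (a + length B)) ?ys)) = 0" by simp
  qed simp
  finally show ?case unfolding Cons.IH by simp
qed simp

section \<open>Walks in Euclidean space\<close>

definition walk :: "('i \<Rightarrow> 'a::real_vector) \<Rightarrow> 'i list \<Rightarrow> nat \<Rightarrow> 'a" where
  "walk x zs i = sum_list (map x (take i zs))"

lemma inner_sum_list:
  fixes x :: "'i \<Rightarrow> 'a::real_inner"
  shows "w \<bullet> sum_list (map x zs) = sum_list (map (\<lambda>z. w \<bullet> x z) zs)"
  by (induction zs) (auto simp: inner_add_right)

lemma inner_walk: "w \<bullet> walk x zs i = sum_list (map (\<lambda>z. w \<bullet> x z) (take i zs))"
  by (simp add: walk_def inner_sum_list)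

definition block_orthogonal :: "('i \<Rightarrow> 'a::euclidean_space) \<Rightarrow> 'i set list \<Rightarrow> 'a set" where
  "block_orthogonal x As = {w. \<forall>A\<in>set As. w \<bullet> sum x A = 0}"

lemma subspace_block_orthogonal: "subspace (block_orthogonal x As)"
  by (auto simp: subspace_def block_orthogonal_def inner_add_left)

text \<open>
  A direction is constant on the walk at the cut positions iff it annihilates the block sums. This is
  why the level space does not see the order of the steps within the pieces.
\<close>

lemma level_space_cuts:
  fixes x :: "'i \<Rightarrow> 'a::euclidean_space"
  assumes "\<And>B. B \<in> set Bs \<Longrightarrow> distinct B"
  shows "level_space (walk x (pre @ concat Bs @ post)) (set (cuts (length pre) Bs)) =
    block_orthogonal x (map set Bs)"
proof (intro set_eqI)
  fix w
  let ?l = "length pre" and ?ys = "concat Bs @ post"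
  let ?s = "walk x (pre @ ?ys)"
  have diff: "w \<bullet> (?s i - ?s ?l) = sum_list (map (\<lambda>z. w \<bullet> x z) (take (i - ?l) ?ys))"
    if "i \<in> set (cuts ?l Bs)" for i
    using cuts_bounds[OF that] by (simp add: inner_diff_right inner_walk)
  have "w \<in> level_space ?s (set (cuts ?l Bs)) \<longleftrightarrow> (\<forall>i\<in>set (cuts ?l Bs). w \<bullet> (?s i - ?s ?l) = 0)"
  proof
    assume "\<forall>i\<in>set (cuts ?l Bs). w \<bullet> (?s i - ?s ?l) = 0"
    then show "w \<in> level_space ?s (set (cuts ?l Bs))"
      by (intro level_spaceI[where c = "w \<bullet> ?s ?l"]) (simp add: inner_diff_right)
  next
    assume w: "w \<in> level_space ?s (set (cuts ?l Bs))"
    show "\<forall>i\<in>set (cuts ?l Bs). w \<bullet> (?s i - ?s ?l) = 0"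
      using level_spaceD[OF w _ cuts_start] by (rule ballI)
  qed
  also have "\<dots> \<longleftrightarrow> (\<forall>i\<in>set (cuts ?l Bs). sum_list (map (\<lambda>z. w \<bullet> x z) (take (i - ?l) ?ys)) = 0)"
    using diff by simp
  also have "\<dots> \<longleftrightarrow> (\<forall>B\<in>set Bs. sum_list (map (\<lambda>z. w \<bullet> x z) B) = 0)"
    by (rule walk_constant_on_cuts_iff)
  also have "\<dots> \<longleftrightarrow> w \<in> block_orthogonal x (map set Bs)"
    using assms by (simp add: block_orthogonal_def sum_list_distinct_conv_sum_set inner_sum_right)
  finally show "w \<in> level_space ?s (set (cuts ?l Bs)) \<longleftrightarrow> w \<in> block_orthogonal x (map set Bs)" .
qed

definition index_sets :: "nat \<Rightarrow> 'i set \<Rightarrow> nat set set" where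
  "index_sets j U = {J. J \<subseteq> {0..card U} \<and> card J = Suc j}"

lemma splits_bij_betw_index_sets:
  "bij_betw (\<lambda>(pre, Bs, post). (pre @ concat Bs @ post, set (cuts (length pre) Bs)))
     (splits j U) (permutations_of_set U \<times> index_sets j U)"
proof (rule bij_betwI')
  fix a b assume "a \<in> splits j U" "b \<in> splits j U"
  moreover obtain p Bs q p' Bs' q' where ab: "a = (p, Bs, q)" "b = (p', Bs', q')"
    by (metis prod.exhaust)
  ultimately have ne: "[] \<notin> set Bs" "[] \<notin> set Bs'" by (auto simp: splits_def)
  have "p = p' \<and> Bs = Bs' \<and> q = q'"
    if eq: "p @ concat Bs @ q = p' @ concat Bs' @ q'"
      and c: "set (cuts (length p) Bs) = set (cuts (length p') Bs')"
  proof -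
    have "cuts (length p) Bs = cuts (length p') Bs'"
      using strict_sorted_equal[OF sorted_cuts[OF ne(2)] sorted_cuts[OF ne(1)]] c by simp
    moreover from this have "length p = length p'" by (metis hd_cuts)
    ultimately show ?thesis using eq cuts_inject[of "length p" Bs Bs' q q'] by auto
  qed
  then show "((case a of (pre, Bs, post) \<Rightarrow> (pre @ concat Bs @ post, set (cuts (length pre) Bs))) =
      (case b of (pre, Bs, post) \<Rightarrow> (pre @ concat Bs @ post, set (cuts (length pre) Bs)))) = (a = b)"
    by (auto simp: ab)
next
  fix a assume "a \<in> splits j U"
  moreover obtain pre Bs post where a: "a = (pre, Bs, post)" by (metis prod.exhaust)
  ultimately have "pre @ concat Bs @ post \<in> permutations_of_set U" "length Bs = j" "[] \<notin> set Bs"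
    by (auto simp: splits_def)
  moreover from this have "length (pre @ concat Bs @ post) = card U"
    using length_finite_permutations_of_set by blast
  moreover have "distinct (cuts (length pre) Bs)"
    using sorted_cuts[OF \<open>[] \<notin> set Bs\<close>] by (simp add: strict_sorted_iff)
  ultimately show "(case a of (pre, Bs, post) \<Rightarrow> (pre @ concat Bs @ post, set (cuts (length pre) Bs)))
      \<in> permutations_of_set U \<times> index_sets j U"
    using cuts_bounds[of _ "length pre" Bs]
    by (fastforce simp: a index_sets_def distinct_card length_cuts)
next
  fix z assume "z \<in> permutations_of_set U \<times> index_sets j U"
  then obtain zs J where z: "z = (zs, J)" "zs \<in> permutations_of_set U" "J \<subseteq> {0..card U}" "card J = Suc j"
    by (auto simp: index_sets_def)
  have len: "length zs = card U" using z length_finite_permutations_of_set by blast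
  have fJ: "finite J" using z finite_subset by blast
  define cs where "cs = sorted_list_of_set J"
  have cs: "set cs = J" "sorted_wrt (<) cs" "length cs = Suc j"
    using fJ z by (auto simp: cs_def)
  then obtain a js where ajs: "cs = a # js" by (cases cs) auto
  have bounds: "i \<le> card U" if "i \<in> set cs" for i using that cs z by auto
  then have a: "a \<le> length zs" and "\<And>i. i \<in> set js \<Longrightarrow> i \<le> a + length (drop a zs)"
    using len by (auto simp: ajs)
  with cs(2) obtain Bs post where Bs: "drop a zs = concat Bs @ post" "[] \<notin> set Bs" "cuts a Bs = a # js"
    using cuts_surj[of a js "drop a zs"] unfolding ajs by blast
  have "take a zs @ concat Bs @ post = zs" by (simp flip: Bs(1))
  moreover have "length Bs = j" using arg_cong[OF Bs(3), of length] cs ajs by (simp add: length_cuts)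
  ultimately have "(take a zs, Bs, post) \<in> splits j U" using Bs z by (simp add: splits_def)
  moreover have "z = (take a zs @ concat Bs @ post, set (cuts (length (take a zs)) Bs))"
    using z(1) a cs(1) Bs \<open>take a zs @ concat Bs @ post = zs\<close> by (simp add: min_absorb2 ajs)
  ultimately show "\<exists>x\<in>splits j U. z = (case x of (pre, Bs, post) \<Rightarrow>
      (pre @ concat Bs @ post, set (cuts (length pre) Bs)))"
    by (intro bexI[of _ "(take a zs, Bs, post)"]) auto
qed

text \<open>
  The values of the projected direction differ on and off \<open>J\<close>, for every ordering of the steps and
  every admissible \<open>J\<close>.
\<close>

definition generic_direction :: "('i \<Rightarrow> 'a::euclidean_space) \<Rightarrow> 'i set \<Rightarrow> nat \<Rightarrow> 'a \<Rightarrow> bool" where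
  "generic_direction x U j u \<longleftrightarrow>
     (\<forall>zs\<in>permutations_of_set U. \<forall>J\<in>index_sets j U. \<forall>i\<in>{0..card U} - J. \<forall>k\<in>J.
        closest_point (level_space (walk x zs) J) u \<bullet> (walk x zs i - walk x zs k) \<noteq> 0)"

text \<open>
  Pairs of an ordering and an index set are splittings. For a splitting with block sets \<open>As\<close> the walk
  is projected to the line spanned by \<open>v As\<close>, which gives increments \<open>y As\<close> depending on the block sets
  only.
\<close>

lemma card_strict_index_sets:
  fixes x :: "'i \<Rightarrow> 'a::euclidean_space"
  assumes U: "finite U" and u: "generic_direction x U j u"
  shows "(\<Sum>zs\<in>permutations_of_set U. real (card {J \<in> index_sets j U.
       closest_point (level_space (walk x zs) J) u \<in> strict_maximizers (walk x zs) {0..card U} J})) =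
     fact j * real (stirling (card U + 1) (j + 1))"
proof -
  define v where "v As = closest_point (block_orthogonal x As) u" for As
  define y where "y As z = v As \<bullet> x z" for As z
  define \<phi> :: "'i list \<times> 'i list list \<times> 'i list \<Rightarrow> 'i list \<times> nat set"
    where "\<phi> = (\<lambda>(pre, Bs, post). (pre @ concat Bs @ post, set (cuts (length pre) Bs)))"
  have bij: "bij_betw \<phi> (splits j U) (permutations_of_set U \<times> index_sets j U)"
    unfolding \<phi>_def by (rule splits_bij_betw_index_sets)
  have zero: "sum (y As) A = 0" if "A \<in> set As" for As A
    using closest_point_subspace_in[OF subspace_block_orthogonal, of x As u] that
    by (simp add: y_def v_def block_orthogonal_def inner_sum_right)
  define S where "S = (\<lambda>(zs, J). closest_point (level_space (walk x zs) J) u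
    \<in> strict_maximizers (walk x zs) {0..card U} J)"
  have key: "S (\<phi> c) \<longleftrightarrow> split_ok (y (blocks c)) (\<lambda>t. t < 0) c"
    "split_ok (y (blocks c)) (\<lambda>t. t \<noteq> 0) c" if c: "c \<in> splits j U" for c
  proof -
    obtain pre Bs post where c': "c = (pre, Bs, post)" by (metis prod.exhaust)
    define zs where "zs = pre @ concat Bs @ post"
    define J where "J = set (cuts (length pre) Bs)"
    have zs: "zs \<in> permutations_of_set U" "[] \<notin> set Bs"
      using c by (auto simp: splits_def c' zs_def)
    note len = length_finite_permutations_of_set[OF zs(1)]
    have J: "J \<in> index_sets j U" "length pre \<in> J"
      using bij_betw_apply[OF bij c] by (auto simp: \<phi>_def c' J_def cuts_start)
    have dist: "distinct B" if "B \<in> set Bs" for B using c that by (simp add: c' splits_iff)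
    have sums: "sum_list (map (y (map set Bs)) B) = 0" if "B \<in> set Bs" for B
      using zero[of "set B" "map set Bs"] that dist[OF that] by (simp add: sum_list_distinct_conv_sum_set)
    have v: "closest_point (level_space (walk x zs) J) u = v (map set Bs)"
      using dist by (simp add: v_def zs_def J_def level_space_cuts)
    have walk: "v (map set Bs) \<bullet> walk x zs i = sum_list (map (y (map set Bs)) (take i zs))" for i
      by (simp add: inner_walk y_def[abs_def])
    have ok: "split_ok (y (map set Bs)) Q c \<longleftrightarrow> (\<forall>i\<in>{0..card U} - J.
        Q (v (map set Bs) \<bullet> walk x zs i - v (map set Bs) \<bullet> walk x zs (length pre)))" for Q
      unfolding walk c' using split_ok_iff[OF zs(2) sums, of Q pre post] len by (simp add: zs_def J_def)
    have const: "v (map set Bs) \<bullet> walk x zs k = v (map set Bs) \<bullet> walk x zs (length pre)" if "k \<in> J" for k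
      using level_spaceD[OF closest_point_subspace_in[OF subspace_level_space] that J(2), of "walk x zs" u]
      by (simp add: v inner_diff_right)
    have "S (\<phi> c) \<longleftrightarrow> (\<forall>i\<in>{0..card U} - J. \<forall>k\<in>J. v (map set Bs) \<bullet> walk x zs i < v (map set Bs) \<bullet> walk x zs k)"
      by (simp add: S_def \<phi>_def c' strict_maximizers_def flip: zs_def J_def v)
    also have "\<dots> \<longleftrightarrow> (\<forall>i\<in>{0..card U} - J. v (map set Bs) \<bullet> walk x zs i < v (map set Bs) \<bullet> walk x zs (length pre))"
      using const J(2) by metis
    also have "\<dots> \<longleftrightarrow> split_ok (y (blocks c)) (\<lambda>t. t < 0) c"
      using ok[of "\<lambda>t. t < 0"] by (simp add: c')
    finally show "S (\<phi> c) \<longleftrightarrow> split_ok (y (blocks c)) (\<lambda>t. t < 0) c" .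
    have "v (map set Bs) \<bullet> walk x zs i \<noteq> v (map set Bs) \<bullet> walk x zs (length pre)" if "i \<in> {0..card U} - J" for i
      using u zs(1) J that unfolding generic_direction_def v[symmetric] inner_diff_right right_minus_eq by blast
    then show "split_ok (y (blocks c)) (\<lambda>t. t \<noteq> 0) c"
      using ok[of "\<lambda>t. t \<noteq> 0"] by (simp add: c')
  qed
  have "(\<Sum>zs\<in>permutations_of_set U. card {J \<in> index_sets j U. S (zs, J)}) =
      card (SIGMA zs:permutations_of_set U. {J \<in> index_sets j U. S (zs, J)})"
    by (rule card_SigmaI[symmetric]) (auto simp: index_sets_def)
  also have "(SIGMA zs:permutations_of_set U. {J \<in> index_sets j U. S (zs, J)}) =
      {z \<in> permutations_of_set U \<times> index_sets j U. S z}"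
    by auto
  also have "\<dots> = \<phi> ` {c \<in> splits j U. split_ok (y (blocks c)) (\<lambda>t. t < 0) c}"
    unfolding bij_betw_imp_surj_on[OF bij, symmetric] using key(1) by blast
  also have "card \<dots> = card {c \<in> splits j U. split_ok (y (blocks c)) (\<lambda>t. t < 0) c}"
    using bij by (intro card_image) (auto simp: bij_betw_def intro: inj_on_subset)
  finally have "(\<Sum>zs\<in>permutations_of_set U. card {J \<in> index_sets j U. S (zs, J)}) =
      card {c \<in> splits j U. split_ok (y (blocks c)) (\<lambda>t. t < 0) c}" .
  then show ?thesis
    using card_negative_splits[OF U zero key(2)] by (simp add: S_def flip: of_nat_sum)
qed

section \<open>Generic steps and the angle sum over all orderings\<close>

text \<open>
  Expresses general position through the measurable function \<open>dim\<close>.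
\<close>

lemma dependent_family_iff_dim:
  fixes f :: "'i \<Rightarrow> 'a::euclidean_space"
  assumes I: "finite I"
  shows "\<not> dependent_family I f \<longleftrightarrow> dim (f ` I) = card I"
proof
  assume nd: "\<not> dependent_family I f"
  have inj: "inj_on f I"
  proof (rule inj_onI, rule ccontr)
    fix i k assume ik: "i \<in> I" "k \<in> I" "f i = f k" "i \<noteq> k"
    let ?c = "\<lambda>m. (if m = i then 1 else 0) - (if m = k then 1 else (0::real))"
    have "(\<Sum>m\<in>I. ?c m *\<^sub>R f m) = f i - f k"
      using I ik by (simp add: scaleR_left_diff_distrib sum_subtractf if_distrib[of "\<lambda>c. c *\<^sub>R _"] cong: if_cong)
    then have "dependent_family I f"
      unfolding dependent_family_def using ik by (intro exI[of _ ?c]) auto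
    with nd show False by simp
  qed
  have "independent (f ` I)"
  proof
    assume "dependent (f ` I)"
    then obtain u where u: "\<exists>v\<in>f ` I. u v \<noteq> 0" "(\<Sum>v\<in>f ` I. u v *\<^sub>R v) = 0"
      using dependent_finite[of "f ` I"] I by auto
    then have "dependent_family I f"
      unfolding dependent_family_def using inj by (intro exI[of _ "u \<circ> f"]) (auto simp: sum.reindex)
    with nd show False by simp
  qed
  then show "dim (f ` I) = card I" using inj by (simp add: dim_eq_card_independent card_image)
next
  assume d: "dim (f ` I) = card I"
  have "dim (f ` I) \<le> card (f ` I)" using I by (intro dim_le_card') auto
  then have inj: "inj_on f I" using d I card_image_le[OF I, of f] by (intro eq_card_imp_inj_on) auto
  have ind: "independent (f ` I)"
    using I d inj by (intro card_le_dim_spanning[of _ "f ` I"]) (auto simp: card_image span_superset)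
  show "\<not> dependent_family I f"
  proof
    assume "dependent_family I f"
    then obtain c i where c: "i \<in> I" "c i \<noteq> 0" "(\<Sum>i\<in>I. c i *\<^sub>R f i) = 0"
      by (auto simp: dependent_family_def)
    have "(\<Sum>v\<in>f ` I. c (the_inv_into I f v) *\<^sub>R v) = 0"
      using c inj by (simp add: sum.reindex the_inv_into_f_f)
    moreover have "\<exists>v\<in>f ` I. c (the_inv_into I f v) \<noteq> 0"
      using c inj by (auto simp: the_inv_into_f_f)
    ultimately have "dependent (f ` I)" using dependent_finite[of "f ` I"] I by auto
    with ind show False by simp
  qed
qed

lemma dependent_family_mono:
  assumes "dependent_family K f" "K \<subseteq> I" "finite I"
  shows "dependent_family I f"
proof -
  obtain c i where c: "i \<in> K" "c i \<noteq> 0" "(\<Sum>i\<in>K. c i *\<^sub>R f i) = 0"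
    using assms(1) by (auto simp: dependent_family_def)
  have "(\<Sum>i\<in>I. (if i \<in> K then c i else 0) *\<^sub>R f i) = (\<Sum>i\<in>K. c i *\<^sub>R f i)"
    using assms by (intro sum.mono_neutral_cong_right) auto
  then show ?thesis
    unfolding dependent_family_def using c assms(2)
    by (intro exI[of _ "\<lambda>i. if i \<in> K then c i else 0"]) auto
qed

definition generic_steps :: "('i \<Rightarrow> 'a::euclidean_space) \<Rightarrow> 'i set \<Rightarrow> bool" where
  "generic_steps x U \<longleftrightarrow> (\<forall>zs\<in>permutations_of_set U. \<forall>I. I \<subseteq> {1..card U} \<and> card I = DIM('a) \<longrightarrow>
     \<not> dependent_family I (walk x zs))"

text \<open>
  A cyclic shift of the steps turns increments after time \<open>k\<close> into positions of a walk from the origin.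
\<close>

lemma walk_rotate:
  assumes "k \<le> i" "i \<le> length zs"
  shows "walk x (drop k zs @ take k zs) (i - k) = walk x zs i - walk x zs k"
proof -
  have "take i zs = take k zs @ take (i - k) (drop k zs)"
    using take_add[of k "i - k" zs] assms by simp
  then show ?thesis using assms by (simp add: walk_def)
qed

text \<open>
  General position speaks of linear independence of positions at positive times. Affine independence
  of any \<open>DIM('a) + 1\<close> positions, time \<open>0\<close> allowed, follows by rotating the steps so that
  the earliest of these positions becomes the origin.
\<close>

lemma generic_steps_aff_dim:
  fixes x :: "'i \<Rightarrow> 'a::euclidean_space"
  assumes x: "generic_steps x U" and n: "DIM('a) \<le> card U" and zs: "zs \<in> permutations_of_set U"
    and J: "J \<subseteq> {0..card U}" "J \<noteq> {}" "card J \<le> DIM('a) + 1"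
  shows "aff_dim (walk x zs ` J) = int (card J) - 1"
proof -
  define k where "k = Min J"
  have fJ: "finite J" using J finite_subset by blast
  have k: "k \<in> J" "\<And>i. i \<in> J \<Longrightarrow> k \<le> i" using fJ J by (auto simp: k_def)
  have len: "length zs = card U" using zs length_finite_permutations_of_set by blast
  define zs' where "zs' = drop k zs @ take k zs"
  have zs': "zs' \<in> permutations_of_set U"
    using zs set_append[of "take k zs" "drop k zs"] distinct_append[of "take k zs" "drop k zs"]
    by (auto simp: zs'_def permutations_of_set_def Int_commute)
  define K where "K = (\<lambda>i. i - k) ` (J - {k})"
  have K: "K \<subseteq> {1..card U}"
  proof
    fix m assume "m \<in> K"
    then obtain i where i: "i \<in> J" "i \<noteq> k" "m = i - k" by (auto simp: K_def)
    then have "k < i" "i \<le> card U" using k(2)[of i] J(1) by auto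
    then show "m \<in> {1..card U}" unfolding i(3) atLeastAtMost_iff by linarith
  qed
  have "inj_on (\<lambda>i. i - k) (J - {k})" using k(2) by (intro inj_onI) (metis DiffD1 eq_diff_iff)
  then have cK: "card K = card J - 1" using fJ k by (simp add: K_def card_image)
  then have cK': "card K \<le> DIM('a)" using J(3) by linarith
  obtain I where I: "K \<subseteq> I" "I \<subseteq> {1..card U}" "card I = DIM('a)"
    using exists_subset_between[of K "DIM('a)" "{1..card U}"] K n cK' by auto
  have fI: "finite I" using I finite_subset by blast
  have "\<not> dependent_family I (walk x zs')" using x zs' I by (simp add: generic_steps_def)
  then have "\<not> dependent_family K (walk x zs')" using dependent_family_mono I fI by blast
  then have dK: "dim (walk x zs' ` K) = card J - 1"
    using dependent_family_iff_dim[of K "walk x zs'"] fJ cK by (simp add: K_def)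
  have "walk x zs' ` K = (\<lambda>i. walk x zs i - walk x zs k) ` (J - {k})"
    unfolding K_def image_image zs'_def
    by (intro image_cong walk_rotate) (use J len k in auto)
  moreover have "(\<lambda>y. y - walk x zs k) ` walk x zs ` J = insert 0 ((\<lambda>i. walk x zs i - walk x zs k) ` (J - {k}))"
    using k(1) by auto
  ultimately have "dim ((\<lambda>y. y - walk x zs k) ` walk x zs ` J) = card J - 1"
    using dK by (simp add: dim_insert span_0)
  then show ?thesis
    using aff_dim_eq_dim_subtract[of "walk x zs k" "walk x zs ` J"] k(1) fJ J(2)
    by (simp add: hull_inc of_nat_diff Suc_le_eq card_gt_0_iff)
qed

lemma generic_steps_aff_dim_eq_iff:
  fixes x :: "'i \<Rightarrow> 'a::euclidean_space"
  assumes x: "generic_steps x U" and n: "DIM('a) \<le> card U" and zs: "zs \<in> permutations_of_set U"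
    and j: "j < DIM('a)"
  shows "{J. J \<subseteq> {0..card U} \<and> aff_dim (walk x zs ` J) = int j} = index_sets j U"
proof (intro set_eqI iffI)
  fix J assume "J \<in> {J. J \<subseteq> {0..card U} \<and> aff_dim (walk x zs ` J) = int j}"
  then have J: "J \<subseteq> {0..card U}" "aff_dim (walk x zs ` J) = int j" "J \<noteq> {}" by auto
  have "card J \<le> DIM('a) + 1"
  proof (rule ccontr)
    assume "\<not> card J \<le> DIM('a) + 1"
    then have "DIM('a) + 1 \<le> card J" by simp
    then obtain J' where J': "J' \<subseteq> J" "card J' = DIM('a) + 1"
      by (rule obtain_subset_with_card_n)
    then have "aff_dim (walk x zs ` J') = int (card J') - 1"
      using J by (intro generic_steps_aff_dim[OF x n zs]) auto
    moreover have "aff_dim (walk x zs ` J') \<le> aff_dim (walk x zs ` J)"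
      using J' by (intro aff_dim_subset image_mono)
    ultimately show False using J J' j by simp
  qed
  then show "J \<in> index_sets j U"
    using generic_steps_aff_dim[OF x n zs J(1,3)] J by (simp add: index_sets_def)
next
  fix J assume "J \<in> index_sets j U"
  then show "J \<in> {J. J \<subseteq> {0..card U} \<and> aff_dim (walk x zs ` J) = int j}"
    using generic_steps_aff_dim[OF x n zs, of J] j by (cases "J = {}") (auto simp: index_sets_def)
qed

text \<open>
  For generic steps a point outside \<open>J\<close> is affinely independent of the points in \<open>J\<close>, so its
  difference to one of them has a component in the level space.
\<close>

lemma closest_point_level_space_nonzero:
  fixes x :: "'i \<Rightarrow> 'a::euclidean_space"
  assumes x: "generic_steps x U" and n: "DIM('a) \<le> card U" and zs: "zs \<in> permutations_of_set U"
    and j: "j < DIM('a)" and J: "J \<in> index_sets j U" and i: "i \<in> {0..card U} - J" and k: "k \<in> J"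
  shows "closest_point (level_space (walk x zs) J) (walk x zs i - walk x zs k) \<noteq> 0"
proof -
  let ?s = "walk x zs"
  have J': "J \<subseteq> {0..card U}" "card J = Suc j" "finite J" "J \<noteq> {}"
    using J finite_subset by (auto simp: index_sets_def)
  let ?D = "(\<lambda>m. ?s m - ?s k) ` J"
  have "aff_dim (?s ` J) = int (dim ?D)"
    using aff_dim_eq_dim_subtract[of "?s k" "?s ` J"] k by (simp add: image_image hull_inc)
  moreover have "aff_dim (?s ` insert i J) = int (dim (insert (?s i - ?s k) ?D))"
    using aff_dim_eq_dim_subtract[of "?s k" "?s ` insert i J"] k by (simp add: image_image hull_inc)
  moreover have "aff_dim (?s ` J) = int j"
    using generic_steps_aff_dim[OF x n zs J'(1,4)] J' j by simp
  moreover have "aff_dim (?s ` insert i J) = int j + 1"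
    using generic_steps_aff_dim[OF x n zs, of "insert i J"] J' j i by simp
  ultimately have notin: "?s i - ?s k \<notin> span ?D" by (auto simp: dim_insert)
  obtain js where js: "set js = J" using J'(3) finite_list by blast
  show ?thesis
    using notin unfolding closest_point_level_space_eq_residual[OF k js] residual_eq_0_iff by (simp add: js)
qed

lemma AE_generic_direction:
  fixes x :: "'i \<Rightarrow> 'a::euclidean_space"
  assumes x: "generic_steps x U" and n: "DIM('a) \<le> card U" and j: "j < DIM('a)"
  shows "AE u in ball_measure. generic_direction x U j u"
  unfolding generic_direction_def
proof (intro AE_finite_allI)
  fix zs J i k
  assume *: "zs \<in> permutations_of_set U" "J \<in> index_sets j U" "i \<in> {0..card U} - J" "k \<in> J"
  from AE_ball_measure_inner_nonzero[OF closest_point_level_space_nonzero[OF x n *(1) j *(2-4)]]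
  show "AE u in ball_measure. closest_point (level_space (walk x zs) J) u \<bullet> (walk x zs i - walk x zs k) \<noteq> 0"
    by (simp add: closest_point_subspace_selfadjoint[OF subspace_level_space])
next
  fix J :: "nat set" assume "J \<in> index_sets j U"
  then show "finite J" using finite_subset by (auto simp: index_sets_def)
qed (auto simp: index_sets_def)

text \<open>
  After interchanging sum and integral, the integrand is the number of pairs counted in
  \<open>card_strict_index_sets\<close>, the same for almost every \<open>u\<close>.
\<close>

lemma sum_permutations_direction_prob:
  fixes x :: "'i \<Rightarrow> 'a::euclidean_space"
  assumes U: "finite U" and x: "generic_steps x U" and n: "DIM('a) \<le> card U" and j: "j < DIM('a)"
  shows "(\<Sum>zs\<in>permutations_of_set U.
      \<Sum>J | J \<subseteq> {0..card U} \<and> aff_dim (walk x zs ` J) = int j. direction_prob (walk x zs) {0..card U} J) =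
    fact j * real (stirling (card U + 1) (j + 1))"
proof -
  define E where "E zs J = {u. closest_point (level_space (walk x zs) J) u \<in>
    strict_maximizers (walk x zs) {0..card U} J}" for zs J
  have fin: "finite (index_sets j U)" by (simp add: index_sets_def)
  have E: "E zs J \<in> sets ball_measure" if "J \<in> index_sets j U" for zs J
    unfolding E_def using that finite_subset
    by (intro sets_closest_point_strict_maximizers) (auto simp: index_sets_def)
  have "(\<Sum>zs\<in>permutations_of_set U.
      \<Sum>J | J \<subseteq> {0..card U} \<and> aff_dim (walk x zs ` J) = int j. direction_prob (walk x zs) {0..card U} J) =
      (\<Sum>zs\<in>permutations_of_set U. \<Sum>J\<in>index_sets j U. measure ball_measure (E zs J))"
    by (intro sum.cong generic_steps_aff_dim_eq_iff[OF x n _ j]) (auto simp: direction_prob_def E_def)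
  also have "\<dots> = (\<Sum>zs\<in>permutations_of_set U. \<Sum>J\<in>index_sets j U. (\<integral>u. indicator (E zs J) u \<partial>ball_measure))"
    by (intro sum.cong refl) (simp add: E)
  also have "\<dots> = (\<integral>u. (\<Sum>zs\<in>permutations_of_set U. \<Sum>J\<in>index_sets j U. indicator (E zs J) u) \<partial>ball_measure)"
    using E by (simp add: Bochner_Integration.integral_sum Bochner_Integration.integrable_sum ball_measure.emeasure_finite less_top[symmetric])
  also have "\<dots> = (\<integral>u. fact j * real (stirling (card U + 1) (j + 1)) \<partial>(ball_measure :: 'a measure))"
  proof (rule integral_cong_AE)
    show "(\<lambda>u. \<Sum>zs\<in>permutations_of_set U. \<Sum>J\<in>index_sets j U. indicator (E zs J) u :: real) \<in> borel_measurable ball_measure"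
      by (intro borel_measurable_sum borel_measurable_indicator E)
    show "AE u in ball_measure. (\<Sum>zs\<in>permutations_of_set U. \<Sum>J\<in>index_sets j U. indicator (E zs J) u) =
        fact j * real (stirling (card U + 1) (j + 1))"
      using AE_generic_direction[OF x n j]
    proof eventually_elim
      case (elim u)
      have "(\<Sum>J\<in>index_sets j U. indicator (E zs J) u) = real (card {J \<in> index_sets j U. u \<in> E zs J})" for zs
        using fin by (simp add: indicator_def sum.If_cases Int_def)
      then show ?case
        using card_strict_index_sets[OF U elim] by (simp add: E_def)
    qed
  qed simp
  also have "\<dots> = fact j * real (stirling (card U + 1) (j + 1))"
    by (simp add: ball_measure.prob_space[simplified] del: stirling.simps)
  finally show ?thesis .
qed

section \<open>Exchangeable random steps\<close>

lemma measurable_walk: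
  assumes "\<And>z. z \<in> set zs \<Longrightarrow> (\<lambda>\<omega>. \<xi> z \<omega>) \<in> borel_measurable M"
  shows "(\<lambda>\<omega>. walk (\<lambda>z. \<xi> z \<omega>) zs i :: 'a::euclidean_space) \<in> borel_measurable M"
  using assms
proof (induction zs arbitrary: i)
  case Nil
  then show ?case by (simp add: walk_def)
next
  case (Cons z zs)
  show ?case
  proof (cases i)
    case (Suc k)
    have "(\<lambda>\<omega>. \<xi> z \<omega> + walk (\<lambda>z. \<xi> z \<omega>) zs k) \<in> borel_measurable M"
      using Cons by (intro borel_measurable_add) auto
    then show ?thesis by (simp add: walk_def Suc)
  qed (simp add: walk_def)
qed

lemma walk_map: "walk x (map \<pi> zs) = walk (x \<circ> \<pi>) zs"
  by (rule ext) (simp add: walk_def take_map)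

lemma walk_cong:
  assumes "\<And>z. z \<in> set zs \<Longrightarrow> x z = x' z"
  shows "walk x zs = walk x' zs"
  unfolding walk_def
  by (intro ext arg_cong[of _ _ sum_list] map_cong refl assms) (auto dest: in_set_takeD)

lemma walk_upt: "i \<le> n \<Longrightarrow> walk x [1..<Suc n] i = (\<Sum>k\<in>{1..i}. x k)"
  by (simp add: walk_def take_upt sum_list_distinct_conv_sum_set atLeastLessThanSuc_atLeastAtMost del: upt_Suc)

lemma permutation_list_eq_map:
  assumes "zs \<in> permutations_of_set {1..n::nat}"
  obtains \<pi> where "\<pi> permutes {1..n}" "zs = map \<pi> [1..<Suc n]"
proof -
  have zs: "set zs = {1..n}" "distinct zs" "length zs = n"
    using assms length_finite_permutations_of_set[OF assms] by (auto simp: permutations_of_set_def)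
  define \<pi> where "\<pi> i = (if i \<in> {1..n} then zs ! (i - 1) else i)" for i
  have "bij_betw (\<lambda>i. i - 1) {1..n} {..<n}"
    by (rule bij_betw_byWitness[where f' = Suc]) auto
  then have "bij_betw ((!) zs \<circ> (\<lambda>i. i - 1)) {1..n} {1..n}"
    using bij_betw_nth[OF zs(2), of "{..<n}" "{1..n}"] zs by (intro bij_betw_trans) auto
  then have "bij_betw \<pi> {1..n} {1..n}"
    by (rule bij_betw_cong[THEN iffD1, rotated]) (auto simp: \<pi>_def)
  then have "\<pi> permutes {1..n}"
    by (rule bij_imp_permutes) (auto simp: \<pi>_def)
  moreover have "zs = map \<pi> [1..<Suc n]"
    using zs by (intro nth_equalityI) (auto simp: \<pi>_def simp del: upt_Suc)
  ultimately show thesis by (rule that)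
qed

lemma exchangeable_distr:
  fixes \<xi> :: "nat \<Rightarrow> 'w \<Rightarrow> 'a::euclidean_space"
  assumes Ex: "exchangeable M n \<xi>" and zs: "zs \<in> permutations_of_set {1..n}"
  obtains \<pi> where "\<pi> permutes {1..n}" "zs = map \<pi> [1..<Suc n]"
    "distr M (PiM {1..n} (\<lambda>_. borel)) (\<lambda>\<omega>. \<lambda>i\<in>{1..n}. \<xi> (\<pi> i) \<omega>) =
     distr M (PiM {1..n} (\<lambda>_. borel)) (\<lambda>\<omega>. \<lambda>i\<in>{1..n}. \<xi> i \<omega>)"
  using permutation_list_eq_map[OF zs] Ex unfolding exchangeable_def by metis

lemma dependent_family_cong:
  assumes "\<And>i. i \<in> I \<Longrightarrow> f i = g i"
  shows "dependent_family I f \<longleftrightarrow> dependent_family I g"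
  using assms by (simp add: dependent_family_def)

lemma sets_dependent_family:
  fixes s :: "'w \<Rightarrow> 'i \<Rightarrow> 'a::euclidean_space"
  assumes I: "finite I" and s: "\<And>i. i \<in> I \<Longrightarrow> (\<lambda>\<omega>. s \<omega> i) \<in> borel_measurable M"
  shows "{\<omega> \<in> space M. \<not> dependent_family I (s \<omega>)} \<in> sets M"
proof -
  obtain js where js: "set js = I" using I finite_list by blast
  have "(\<lambda>\<omega>. dim (set (map (\<lambda>f. f \<omega>) (map (\<lambda>i \<omega>. s \<omega> i) js)))) \<in> measurable M (count_space UNIV)"
    using s js by (intro measurable_dim) auto
  then have [measurable]: "(\<lambda>\<omega>. dim (s \<omega> ` I)) \<in> measurable M (count_space UNIV)"
    by (simp add: js image_image)
  show ?thesis unfolding dependent_family_iff_dim[OF I] by measurable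
qed

context
  fixes M :: "'w measure" and \<xi> :: "nat \<Rightarrow> 'w \<Rightarrow> 'a::euclidean_space" and n :: nat
  assumes meas: "\<And>i. i \<in> {1..n} \<Longrightarrow> \<xi> i \<in> borel_measurable M"
    and Ex: "exchangeable M n \<xi>"
begin

lemma measurable_steps:
  assumes "\<pi> permutes {1..n}"
  shows "(\<lambda>\<omega>. \<lambda>i\<in>{1..n}. \<xi> (\<pi> i) \<omega>) \<in> measurable M (PiM {1..n} (\<lambda>_. borel))"
  using meas permutes_in_image[OF assms] by (intro measurable_restrict) blast

lemma walk_permuted_steps:
  assumes "\<pi> permutes {1..n}"
  shows "walk (\<lambda>i\<in>{1..n}. \<xi> (\<pi> i) \<omega>) [1..<Suc n] = walk (\<lambda>i. \<xi> i \<omega>) (map \<pi> [1..<Suc n])"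
  unfolding walk_map by (rule walk_cong) auto

text \<open>
  The reordered steps have the same law, so an almost sure property of the walk holds for all its
  reorderings as well.
\<close>

lemma AE_walk_permuted:
  assumes zs: "zs \<in> permutations_of_set {1..n}"
    and P: "{x \<in> space (PiM {1..n} (\<lambda>_. borel)). P (walk x [1..<Suc n])} \<in> sets (PiM {1..n} (\<lambda>_. borel))"
    and ae: "AE \<omega> in M. P (walk (\<lambda>i. \<xi> i \<omega>) [1..<Suc n])"
  shows "AE \<omega> in M. P (walk (\<lambda>i. \<xi> i \<omega>) zs)"
proof -
  obtain \<pi> where \<pi>: "\<pi> permutes {1..n}" "zs = map \<pi> [1..<Suc n]"
    "distr M (PiM {1..n} (\<lambda>_. borel)) (\<lambda>\<omega>. \<lambda>i\<in>{1..n}. \<xi> (\<pi> i) \<omega>) =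
     distr M (PiM {1..n} (\<lambda>_. borel)) (\<lambda>\<omega>. \<lambda>i\<in>{1..n}. \<xi> i \<omega>)"
    by (rule exchangeable_distr[OF Ex zs])
  have "AE x in distr M (PiM {1..n} (\<lambda>_. borel)) (\<lambda>\<omega>. \<lambda>i\<in>{1..n}. \<xi> i \<omega>). P (walk x [1..<Suc n])"
    using ae walk_permuted_steps[OF permutes_id] measurable_steps[OF permutes_id] P
    by (subst AE_distr_iff) auto
  then have "AE \<omega> in M. P (walk (\<lambda>i\<in>{1..n}. \<xi> (\<pi> i) \<omega>) [1..<Suc n])"
    unfolding \<pi>(3)[symmetric] using P measurable_steps[OF \<pi>(1)] by (subst (asm) AE_distr_iff) auto
  then show ?thesis by (simp only: walk_permuted_steps[OF \<pi>(1)] \<pi>(2)[symmetric])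
qed

lemma integral_walk_permuted:
  fixes g :: "(nat \<Rightarrow> 'a) \<Rightarrow> real"
  assumes zs: "zs \<in> permutations_of_set {1..n}"
    and g: "(\<lambda>x. g (walk x [1..<Suc n])) \<in> borel_measurable (PiM {1..n} (\<lambda>_. borel))"
  shows "(\<integral>\<omega>. g (walk (\<lambda>i. \<xi> i \<omega>) zs) \<partial>M) = (\<integral>\<omega>. g (walk (\<lambda>i. \<xi> i \<omega>) [1..<Suc n]) \<partial>M)"
proof -
  obtain \<pi> where \<pi>: "\<pi> permutes {1..n}" "zs = map \<pi> [1..<Suc n]"
    "distr M (PiM {1..n} (\<lambda>_. borel)) (\<lambda>\<omega>. \<lambda>i\<in>{1..n}. \<xi> (\<pi> i) \<omega>) =
     distr M (PiM {1..n} (\<lambda>_. borel)) (\<lambda>\<omega>. \<lambda>i\<in>{1..n}. \<xi> i \<omega>)"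
    by (rule exchangeable_distr[OF Ex zs])
  have "(\<integral>\<omega>. g (walk (\<lambda>i. \<xi> i \<omega>) (map \<rho> [1..<Suc n])) \<partial>M) =
      (\<integral>x. g (walk x [1..<Suc n]) \<partial>distr M (PiM {1..n} (\<lambda>_. borel)) (\<lambda>\<omega>. \<lambda>i\<in>{1..n}. \<xi> (\<rho> i) \<omega>))"
    if \<rho>: "\<rho> permutes {1..n}" for \<rho>
    by (simp only: integral_distr[OF measurable_steps[OF \<rho>] g] walk_permuted_steps[OF \<rho>])
  from this[OF \<pi>(1)] this[OF permutes_id] show ?thesis
    unfolding \<pi>(2,3) by (simp del: upt_Suc)
qed

end

theorem corollary4p14:
  fixes M :: "'w measure" and \<xi> :: "nat \<Rightarrow> 'w \<Rightarrow> real ^ 'd" and n j :: nat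
  assumes "prob_space M"
    and "CARD('d) \<le> n"
    and "\<And>i. i \<in> {1..n} \<Longrightarrow> \<xi> i \<in> borel_measurable M"
    and Ex: "exchangeable M n \<xi>"
    and GP: "general_position M n \<xi>"
    and "j < CARD('d)"
  shows "prob_space.expectation M
           (\<lambda>\<omega>. \<Sum>F\<in>faces_of_dim j (walk_hull \<xi> n \<omega>). solid_angle (normal_cone (walk_hull \<xi> n \<omega>) F))
         = fact j / fact n * real (stirling (n + 1) (j + 1))"
proof -
  interpret prob_space M by fact
  note meas = assms(3)
  let ?perms = "permutations_of_set {1..n}" and ?id = "[1..<Suc n]"
  define X where "X \<omega> = (\<lambda>i. \<xi> i \<omega>)" for \<omega>
  define g :: "(nat \<Rightarrow> real ^ 'd) \<Rightarrow> real" where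
    "g s = (\<Sum>J | J \<subseteq> {0..n} \<and> aff_dim (s ` J) = int j. direction_prob s {0..n} J)" for s
  have dim: "DIM(real ^ 'd) \<le> card {1..n}" "j < DIM(real ^ 'd)" using assms(2,6) by auto
  have id: "?id \<in> ?perms" by (auto simp: permutations_of_set_def)

  have angle_sum: "(\<Sum>F\<in>faces_of_dim j (walk_hull \<xi> n \<omega>). solid_angle (normal_cone (walk_hull \<xi> n \<omega>) F)) =
      g (walk (X \<omega>) ?id)" for \<omega>
  proof -
    have "walk_hull \<xi> n \<omega> = convex hull (walk (X \<omega>) ?id ` {0..n})"
      unfolding walk_hull_def
      by (intro arg_cong[of _ _ "(hull) convex"] image_cong)
         (simp_all only: walk_upt partial_sum_def X_def atLeastAtMost_iff)
    then show ?thesis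
      using sum_solid_angle_eq_sum_direction_prob[OF finite_atLeastAtMost dim(2)] by (simp add: g_def del: upt_Suc)
  qed

  \<comment> \<open>The same function of the points is used for all orderings; its measurability on the product
    space is what allows the laws of reordered steps to be compared.\<close>
  have g_PiM: "(\<lambda>x. g (walk x ?id)) \<in> borel_measurable (PiM {1..n} (\<lambda>_. borel))"
    unfolding g_def
    by (intro borel_measurable_sum_direction_prob measurable_walk measurable_component_singleton) auto
  have g_meas: "(\<lambda>\<omega>. g (walk (X \<omega>) zs)) \<in> borel_measurable M" if "zs \<in> ?perms" for zs
    unfolding g_def X_def using that meas
    by (intro borel_measurable_sum_direction_prob measurable_walk) (auto simp: permutations_of_set_def)
  have g_bound: "norm (g s) \<le> real (card (Pow {0..n}))" for s
  proof -
    have "norm (g s) \<le> (\<Sum>J | J \<subseteq> {0..n} \<and> aff_dim (s ` J) = int j. 1)"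
      unfolding g_def by (rule order_trans[OF norm_sum sum_mono]) (simp add: direction_prob_def)
    also have "\<dots> \<le> real (card (Pow {0..n}))"
      by (simp del: card_Pow) (intro card_mono; auto)
    finally show ?thesis .
  qed
  have g_int: "integrable M (\<lambda>\<omega>. g (walk (X \<omega>) zs))" if "zs \<in> ?perms" for zs
    using g_bound by (intro integrable_const_bound[where B = "real (card (Pow {0..n}))"] g_meas that) auto

  have "AE \<omega> in M. \<not> dependent_family I (walk (X \<omega>) zs)"
    if zs: "zs \<in> ?perms" and I: "I \<in> {I. I \<subseteq> {1..n} \<and> card I = DIM(real ^ 'd)}" for zs I
    unfolding X_def
  proof (rule AE_walk_permuted[OF meas Ex zs])
    have fI: "finite I" using I finite_subset by blast
    show "{x \<in> space (PiM {1..n} (\<lambda>_. borel :: (real ^ 'd) measure)).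
        \<not> dependent_family I (walk x ?id)} \<in> sets (PiM {1..n} (\<lambda>_. borel))"
      by (intro sets_dependent_family fI measurable_walk measurable_component_singleton) auto
    have "AE \<omega> in M. \<not> dependent_family I (\<lambda>i. partial_sum \<xi> i \<omega>)"
      using GP I by (auto simp: general_position_def)
    moreover have "dependent_family I (\<lambda>i. partial_sum \<xi> i \<omega>) \<longleftrightarrow> dependent_family I (walk (\<lambda>i. \<xi> i \<omega>) ?id)" for \<omega>
    proof (rule dependent_family_cong)
      fix i assume "i \<in> I"
      then have "i \<le> n" using I by auto
      then show "partial_sum \<xi> i \<omega> = walk (\<lambda>i. \<xi> i \<omega>) ?id i"
        by (simp only: walk_upt partial_sum_def)
    qed
    ultimately show "AE \<omega> in M. \<not> dependent_family I (walk (\<lambda>i. \<xi> i \<omega>) ?id)" by simp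
  qed
  then have "AE \<omega> in M. \<forall>zs\<in>?perms. \<forall>I\<in>{I. I \<subseteq> {1..n} \<and> card I = DIM(real ^ 'd)}.
      \<not> dependent_family I (walk (X \<omega>) zs)"
    by (intro AE_finite_allI) auto
  then have generic: "AE \<omega> in M. generic_steps (X \<omega>) {1..n}"
    by (rule eventually_mono) (auto simp: generic_steps_def)

  have "fact n * expectation (\<lambda>\<omega>. g (walk (X \<omega>) ?id)) = (\<Sum>zs\<in>?perms. expectation (\<lambda>\<omega>. g (walk (X \<omega>) zs)))"
    unfolding X_def using integral_walk_permuted[OF meas Ex _ g_PiM] by (simp del: upt_Suc)
  also have "\<dots> = expectation (\<lambda>\<omega>. \<Sum>zs\<in>?perms. g (walk (X \<omega>) zs))"
    using g_int by (rule Bochner_Integration.integral_sum[symmetric])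
  also have "\<dots> = expectation (\<lambda>\<omega>. fact j * real (stirling (n + 1) (j + 1)))"
  proof (rule integral_cong_AE)
    show "(\<lambda>\<omega>. \<Sum>zs\<in>?perms. g (walk (X \<omega>) zs)) \<in> borel_measurable M"
      by (intro borel_measurable_sum g_meas)
    show "AE \<omega> in M. (\<Sum>zs\<in>?perms. g (walk (X \<omega>) zs)) = fact j * real (stirling (n + 1) (j + 1))"
      using generic
    proof eventually_elim
      case (elim \<omega>)
      then show ?case
        using sum_permutations_direction_prob[OF finite_atLeastAtMost elim dim] by (simp add: g_def)
    qed
  qed simp
  also have "\<dots> = fact j * real (stirling (n + 1) (j + 1))"
    by (simp add: prob_space del: stirling.simps)
  finally show ?thesis
    unfolding angle_sum by (simp add: field_simps del: upt_Suc stirling.simps)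
qed

end
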